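(* Let $G=(V,E)$ be a graph given by its adjacency matrix, and let $\Delta$ be the maximum degree of $G$. Then $\mathrm{Mand}(G)$ can be computed in time $O\big(|V|(|V|+\Delta^2)\big)$. In particular, if $G$ is chordal, a minimum monitoring edge-geodetic set of $G$ can be computed in time $O\big(|V|(|V|+\Delta^2)\big)$.
   Context: For a graph $G$, a pair $\{a,b\}$ of vertices monitors an edge $e$ if $e$ lies on every shortest path between $a$ and $b$; a set $M\subseteq V$ is a monitoring edge-geodetic set (meg-set) if every edge of $G$ is monitored by some pair of vertices of $M$. A vertex is mandatory if it belongs to every meg-set of $G$, and $\mathrm{Mand}(G)$ denotes the set of mandatory vertices. A graph is chordal if it has no induced cycle of length at least $4$. *)

theory Defs
  imports Main
begin

section \<open>Graphs and monitoring edge-geodetic sets\<close>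

text \<open>Graphs are finite, simple, undirected and have at least one vertex; edges are two-element
  sets. Connectedness is not required.\<close>

definition simple_graph :: "'a set \<Rightarrow> 'a set set \<Rightarrow> bool" where
  "simple_graph V E \<longleftrightarrow>
     finite V \<and> V \<noteq> {} \<and> (\<forall>e\<in>E. \<exists>u\<in>V. \<exists>v\<in>V. u \<noteq> v \<and> e = {u, v})"

definition degree :: "'a set \<Rightarrow> 'a set set \<Rightarrow> 'a \<Rightarrow> nat" where
  "degree V E v = card {u \<in> V. {u, v} \<in> E}"

definition max_degree :: "'a set \<Rightarrow> 'a set set \<Rightarrow> nat" where
  "max_degree V E = Max (degree V E ` V)"

definition is_path :: "'a set \<Rightarrow> 'a set set \<Rightarrow> 'a \<Rightarrow> 'a \<Rightarrow> 'a list \<Rightarrow> bool" where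
  "is_path V E a b p \<longleftrightarrow>
     p \<noteq> [] \<and> hd p = a \<and> last p = b \<and> distinct p \<and> set p \<subseteq> V \<and>
     (\<forall>i. Suc i < length p \<longrightarrow> {p ! i, p ! Suc i} \<in> E)"

definition path_edges :: "'a list \<Rightarrow> 'a set set" where
  "path_edges p = {{p ! i, p ! Suc i} | i. Suc i < length p}"

definition shortest_path :: "'a set \<Rightarrow> 'a set set \<Rightarrow> 'a \<Rightarrow> 'a \<Rightarrow> 'a list \<Rightarrow> bool" where
  "shortest_path V E a b p \<longleftrightarrow>
     is_path V E a b p \<and> (\<forall>q. is_path V E a b q \<longrightarrow> length p \<le> length q)"

text \<open>The first conjunct matters only if the graph is disconnected: without it, two vertices in
  different components would vacuously monitor every edge.\<close>

definition monitors :: "'a set \<Rightarrow> 'a set set \<Rightarrow> 'a \<Rightarrow> 'a \<Rightarrow> 'a set \<Rightarrow> bool" where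
  "monitors V E a b e \<longleftrightarrow>
     (\<exists>p. shortest_path V E a b p) \<and> (\<forall>p. shortest_path V E a b p \<longrightarrow> e \<in> path_edges p)"

definition meg_set :: "'a set \<Rightarrow> 'a set set \<Rightarrow> 'a set \<Rightarrow> bool" where
  "meg_set V E M \<longleftrightarrow> M \<subseteq> V \<and> (\<forall>e\<in>E. \<exists>a\<in>M. \<exists>b\<in>M. monitors V E a b e)"

definition minimum_meg_set :: "'a set \<Rightarrow> 'a set set \<Rightarrow> 'a set \<Rightarrow> bool" where
  "minimum_meg_set V E M \<longleftrightarrow>
     meg_set V E M \<and> (\<forall>M'. meg_set V E M' \<longrightarrow> card M \<le> card M')"

definition Mand :: "'a set \<Rightarrow> 'a set set \<Rightarrow> 'a set" where
  "Mand V E = {v \<in> V. \<forall>M. meg_set V E M \<longrightarrow> v \<in> M}"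

definition induced_cycle :: "'a set \<Rightarrow> 'a set set \<Rightarrow> 'a list \<Rightarrow> bool" where
  "induced_cycle V E c \<longleftrightarrow>
     3 \<le> length c \<and> distinct c \<and> set c \<subseteq> V \<and>
     (\<forall>i j. i < j \<and> j < length c \<longrightarrow>
        ({c ! i, c ! j} \<in> E \<longleftrightarrow> j = Suc i \<or> (i = 0 \<and> Suc j = length c)))"

definition chordal :: "'a set \<Rightarrow> 'a set set \<Rightarrow> bool" where
  "chordal V E \<longleftrightarrow> \<not> (\<exists>c. induced_cycle V E c \<and> 4 \<le> length c)"

section \<open>A random-access machine\<close>

text \<open>Programs of a unit-cost random-access machine, in structured form: named scalar registers,
  named one-dimensional arrays, addition and truncated subtraction as the only arithmetic
  operations. A program mentions finitely many registers and arrays. Every constant, register or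
  array access, arithmetic operation, comparison, assignment and branch costs one unit.\<close>

datatype exp =
    Const nat
  | Reg string
  | Arr string exp
  | Plus exp exp
  | Minus exp exp

datatype test = Less exp exp | Equal exp exp

datatype com =
    Skip
  | Set string exp
  | SetArr string exp exp
  | Seq com com
  | Cond test com com
  | While test com

type_synonym state = "(string \<Rightarrow> nat) \<times> (string \<Rightarrow> nat \<Rightarrow> nat)"

fun exp_val :: "exp \<Rightarrow> state \<Rightarrow> nat" where
  "exp_val (Const k) s = k"
| "exp_val (Reg x) s = fst s x"
| "exp_val (Arr a e) s = snd s a (exp_val e s)"
| "exp_val (Plus e f) s = exp_val e s + exp_val f s"
| "exp_val (Minus e f) s = exp_val e s - exp_val f s"

fun exp_cost :: "exp \<Rightarrow> nat" where
  "exp_cost (Const k) = 1"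
| "exp_cost (Reg x) = 1"
| "exp_cost (Arr a e) = exp_cost e + 1"
| "exp_cost (Plus e f) = exp_cost e + exp_cost f + 1"
| "exp_cost (Minus e f) = exp_cost e + exp_cost f + 1"

fun test_val :: "test \<Rightarrow> state \<Rightarrow> bool" where
  "test_val (Less e f) s \<longleftrightarrow> exp_val e s < exp_val f s"
| "test_val (Equal e f) s \<longleftrightarrow> exp_val e s = exp_val f s"

fun test_cost :: "test \<Rightarrow> nat" where
  "test_cost (Less e f) = exp_cost e + exp_cost f + 1"
| "test_cost (Equal e f) = exp_cost e + exp_cost f + 1"

text \<open>\<open>exec w c s t s'\<close>: started in state \<open>s\<close>, the program \<open>c\<close> halts in state \<open>s'\<close> after \<open>t\<close> units of
  time. All stored values and addresses written to must fit into a machine word, that is, be at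
  most \<open>w\<close>; a program that violates this gets stuck.\<close>

inductive exec :: "nat \<Rightarrow> com \<Rightarrow> state \<Rightarrow> nat \<Rightarrow> state \<Rightarrow> bool" for w :: nat where
  Skip: "exec w Skip s 1 s"
| Set: "exp_val e (r, m) \<le> w \<Longrightarrow>
    exec w (Set x e) (r, m) (exp_cost e + 1) (r(x := exp_val e (r, m)), m)"
| SetArr: "exp_val i (r, m) \<le> w \<Longrightarrow> exp_val e (r, m) \<le> w \<Longrightarrow>
    exec w (SetArr a i e) (r, m) (exp_cost i + exp_cost e + 1)
      (r, m(a := (m a)(exp_val i (r, m) := exp_val e (r, m))))"
| Seq: "exec w c s t s' \<Longrightarrow> exec w d s' t' s'' \<Longrightarrow> exec w (Seq c d) s (t + t') s''"
| CondTrue: "test_val b s \<Longrightarrow> exec w c s t s' \<Longrightarrow> exec w (Cond b c d) s (test_cost b + 1 + t) s'"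
| CondFalse: "\<not> test_val b s \<Longrightarrow> exec w d s t s' \<Longrightarrow> exec w (Cond b c d) s (test_cost b + 1 + t) s'"
| WhileFalse: "\<not> test_val b s \<Longrightarrow> exec w (While b c) s (test_cost b + 1) s"
| WhileTrue: "test_val b s \<Longrightarrow> exec w c s t s' \<Longrightarrow> exec w (While b c) s' t' s'' \<Longrightarrow>
    exec w (While b c) s (test_cost b + 1 + t + t') s''"

lemma exec_deterministic:
  "exec w c s t s' \<Longrightarrow> exec w c s u s'' \<Longrightarrow> u = t \<and> s'' = s'"
proof (induction arbitrary: u s'' rule: exec.induct)
  case (Skip s)
  from Skip.prems show ?case by cases auto
next
  case (Set e r m x)
  from Set.prems show ?case by cases auto
next
  case (SetArr i r m e a)
  from SetArr.prems show ?case by cases auto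
next
  case (Seq c s t s' d t' s'')
  from Seq.prems show ?case by cases (use Seq.IH in blast)
next
  case (CondTrue b s c t s' d)
  from CondTrue.prems show ?case by cases (use CondTrue.hyps(1) CondTrue.IH in blast)+
next
  case (CondFalse b s d t s' c)
  from CondFalse.prems show ?case by cases (use CondFalse.hyps(1) CondFalse.IH in blast)+
next
  case (WhileFalse b s c)
  from WhileFalse.prems show ?case by cases (use WhileFalse.hyps in auto)
next
  case (WhileTrue b s c t s' t' s'')
  from WhileTrue.prems show ?case by cases (use WhileTrue.hyps(1) WhileTrue.IH in blast)+
qed

section \<open>Computing vertex sets from adjacency matrices\<close>

text \<open>The input graph has vertices \<open>0, \<dots>, n - 1\<close>. Initially register \<open>n\<close> holds the number of
  vertices, array \<open>A\<close> holds the adjacency matrix row by row, and everything else is zero. The output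
  is read off array \<open>S\<close> as a characteristic vector.\<close>

definition input :: "nat \<Rightarrow> nat set set \<Rightarrow> state" where
  "input n E =
     ((\<lambda>_. 0)(''n'' := n),
      (\<lambda>_ _. 0)(''A'' := (\<lambda>k. if k < n * n \<and> {k div n, k mod n} \<in> E then 1 else 0)))"

definition output_set :: "nat \<Rightarrow> state \<Rightarrow> nat set" where
  "output_set n s = {v. v < n \<and> snd s ''S'' v \<noteq> 0}"

text \<open>On every graph in the class \<open>\<C>\<close>, the program outputs a vertex set satisfying the specification
  \<open>\<R>\<close> in time \<open>O(f)\<close>, with words of \<open>O(log n)\<close> bits, i.e. with word values polynomially bounded
  in \<open>n\<close>. The constants depend neither on the graph nor on \<open>n\<close>.\<close>

definition computes_in_time ::
  "com \<Rightarrow> (nat set \<Rightarrow> nat set set \<Rightarrow> bool) \<Rightarrow> (nat set \<Rightarrow> nat set set \<Rightarrow> nat set \<Rightarrow> bool) \<Rightarrow>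
   (nat set \<Rightarrow> nat set set \<Rightarrow> nat) \<Rightarrow> bool" where
  "computes_in_time P \<C> \<R> f \<longleftrightarrow>
     (\<exists>C k. \<forall>n E. simple_graph {..<n} E \<and> \<C> {..<n} E \<longrightarrow>
        (\<exists>t s. exec (k * n ^ k) P (input n E) t s \<and>
           t \<le> C * f {..<n} E \<and> \<R> {..<n} E (output_set n s)))"

end

theory Submission
  imports Defs
begin

text \<open>A vertex \<open>v\<close> is mandatory iff it has a neighbour \<open>u\<close> such that every path \<open>u, v, x\<close> is either
  not induced or part of a 4-cycle: in that case every shortest path through the edge \<open>{u, v}\<close> that
  does not end in \<open>v\<close> has a detour around \<open>v\<close>, and otherwise all other vertices monitor all edges.
  To test this condition, count for every \<open>u\<close> the common neighbours with each vertex at distance at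
  most two by running over the neighbours of its neighbours; with adjacency lists, both counting and
  testing all pairs \<open>v, x\<close> take \<open>O(\<Delta>\<^sup>2)\<close> steps per vertex \<open>u\<close>, and the lists are built
  in \<open>O(n\<^sup>2)\<close> steps.

  In a chordal graph, a path all of whose subpaths with two edges are unique shortest paths is itself
  a unique shortest path. If an end vertex of such a path is not mandatory, the path can be prolonged
  there. Hence every edge lies on a unique shortest path between mandatory vertices, so that the
  mandatory vertices form a meg-set, which is then the smallest one.\<close>

section \<open>Mandatory vertices\<close>

locale sgraph =
  fixes V :: "'a set" and E :: "'a set set"
  assumes simple: "simple_graph V E"
begin

abbreviation adj :: "'a \<Rightarrow> 'a \<Rightarrow> bool" (infix "\<sim>" 50) where
  "u \<sim> v \<equiv> {u, v} \<in> E"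

lemma finite_V: "finite V"
  using simple by (simp add: simple_graph_def)

lemma adj_in_V: "u \<sim> v \<Longrightarrow> u \<in> V" "u \<sim> v \<Longrightarrow> v \<in> V"
  using simple unfolding simple_graph_def by (fastforce simp: doubleton_eq_iff)+

lemma adj_irrefl: "\<not> u \<sim> u"
  using simple unfolding simple_graph_def by (fastforce simp: doubleton_eq_iff)

lemma adj_sym: "u \<sim> v \<Longrightarrow> v \<sim> u"
  by (simp add: insert_commute)

lemma edgeE:
  assumes "e \<in> E"
  obtains u v where "e = {u, v}" "u \<sim> v"
proof -
  from assms simple have "\<exists>u\<in>V. \<exists>v\<in>V. u \<noteq> v \<and> e = {u, v}"
    unfolding simple_graph_def by (elim conjE) (rule bspec)
  with assms that show thesis
    by fast
qed

section \<open>Walks, paths and shortest paths\<close>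

definition walk :: "'a list \<Rightarrow> bool" where
  "walk p \<longleftrightarrow> p \<noteq> [] \<and> set p \<subseteq> V \<and> successively (\<sim>) p"

lemma walk_Cons_Cons: "walk (a # b # p) \<longleftrightarrow> a \<sim> b \<and> walk (b # p)"
  using adj_in_V by (auto simp: walk_def)

lemma walk_singleton: "walk [a] \<longleftrightarrow> a \<in> V"
  by (simp add: walk_def)

lemma walk_append:
  "p \<noteq> [] \<Longrightarrow> q \<noteq> [] \<Longrightarrow> walk (p @ q) \<longleftrightarrow> walk p \<and> walk q \<and> last p \<sim> hd q"
  by (auto simp: walk_def successively_append_iff)

lemma walk_rev: "walk (rev p) \<longleftrightarrow> walk p"
  by (simp add: walk_def successively_rev insert_commute)

lemma is_path_iff:
  "is_path V E a b p \<longleftrightarrow> walk p \<and> distinct p \<and> hd p = a \<and> last p = b"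
  by (auto simp: is_path_def walk_def successively_conv_nth)

text \<open>Splitting the list at an edge instead of indexing it suits the cutting and rerouting of
  paths.\<close>

lemma path_edges_iff: "e \<in> path_edges p \<longleftrightarrow> (\<exists>xs u v ys. p = xs @ u # v # ys \<and> e = {u, v})"
proof
  assume "e \<in> path_edges p"
  then obtain i where i: "Suc i < length p" "e = {p ! i, p ! Suc i}"
    by (auto simp: path_edges_def)
  then have "p = take i p @ p ! i # p ! Suc i # drop (Suc (Suc i)) p"
    by (simp add: Cons_nth_drop_Suc)
  with i(2) show "\<exists>xs u v ys. p = xs @ u # v # ys \<and> e = {u, v}"
    by blast
next
  assume "\<exists>xs u v ys. p = xs @ u # v # ys \<and> e = {u, v}"
  then obtain xs u v ys where "p = xs @ u # v # ys" "e = {u, v}"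
    by blast
  then show "e \<in> path_edges p"
    unfolding path_edges_def by (auto simp: nth_append intro!: exI[of _ "length xs"])
qed

text \<open>The stretch between two occurrences of a repeated vertex is cut out.\<close>

lemma walk_shorten:
  assumes "walk p" "\<not> distinct p"
  obtains q where "walk q" "hd q = hd p" "last q = last p" "length q < length p"
    "set q \<subseteq> set p"
proof -
  obtain xs ys zs y where p: "p = xs @ [y] @ ys @ [y] @ zs"
    using not_distinct_decomp[OF assms(2)] by blast
  show thesis
  proof
    show "walk (xs @ [y] @ zs)"
      using assms(1) unfolding p walk_def by (auto simp: successively_append_iff successively_Cons)
  qed (auto simp: p hd_append)
qed

text \<open>Repeated shortening. The strict inequality for a non-distinct \<open>p\<close> is what
  makes a walk of minimal length a path.\<close>

lemma walk_imp_path: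
  assumes "walk p"
  obtains q where "is_path V E (hd p) (last p) q" "length q \<le> length p"
    "distinct p \<or> length q < length p"
  using assms
proof (induction "length p" arbitrary: p thesis rule: less_induct)
  case less
  show ?case
  proof (cases "distinct p")
    case True
    with less.prems show ?thesis
      by (auto simp: is_path_iff)
  next
    case False
    with walk_shorten less.prems(2) obtain q where
      q: "walk q" "hd q = hd p" "last q = last p" "length q < length p"
      by metis
    with less.hyps obtain q' where "is_path V E (hd q) (last q) q'" "length q' \<le> length q"
      by metis
    with q less.prems(1) show ?thesis
      by (metis le_less_trans less_imp_le)
  qed
qed

lemma shortest_path_le_walk:
  assumes "shortest_path V E a b p" "walk q" "hd q = a" "last q = b"
  shows "length p \<le> length q"
  using assms walk_imp_path[OF assms(2)] unfolding shortest_path_def by (metis order_trans)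

text \<open>If \<open>q\<close> repeated a vertex, its shortening would be a path shorter than
  \<open>p\<close>. Hence a detour has to be checked only for its length, not for
  distinctness.\<close>

lemma shortest_walk_is_shortest_path:
  assumes "shortest_path V E a b p" "walk q" "hd q = a" "last q = b" "length q \<le> length p"
  shows "shortest_path V E a b q"
  using assms walk_imp_path[OF assms(2)] unfolding shortest_path_def is_path_iff
  by (metis leD order_trans)

section \<open>Unique shortest paths\<close>

definition unique_geodesic :: "'a list \<Rightarrow> bool" where
  "unique_geodesic p \<longleftrightarrow> walk p \<and>
     (\<forall>q. walk q \<and> hd q = hd p \<and> last q = last p \<and> length q \<le> length p \<longrightarrow> q = p)"

lemma unique_geodesicD:
  "unique_geodesic p \<Longrightarrow> walk q \<Longrightarrow> hd q = hd p \<Longrightarrow> last q = last p \<Longrightarrow>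
    length q \<le> length p \<Longrightarrow> q = p"
  by (simp add: unique_geodesic_def)

lemma unique_geodesic_distinct:
  assumes "unique_geodesic p"
  shows "distinct p"
  using assms walk_shorten unfolding unique_geodesic_def by (metis less_imp_le less_irrefl)

lemma unique_geodesic_rev:
  assumes "unique_geodesic p"
  shows "unique_geodesic (rev p)"
  unfolding unique_geodesic_def
proof (intro conjI allI impI)
  show "walk (rev p)"
    using assms by (simp add: unique_geodesic_def walk_rev)
  fix q
  assume q: "walk q \<and> hd q = hd (rev p) \<and> last q = last (rev p) \<and> length q \<le> length (rev p)"
  with assms have "p \<noteq> []" "q \<noteq> []"
    by (auto simp: unique_geodesic_def walk_def)
  with q have "rev q = p"
    by (intro unique_geodesicD[OF assms]) (auto simp: walk_rev hd_rev last_rev)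
  then show "q = rev p"
    by auto
qed

lemma unique_geodesic_shortest_path:
  assumes "unique_geodesic p"
  shows "shortest_path V E (hd p) (last p) p"
  using assms unique_geodesic_distinct[OF assms] unfolding shortest_path_def is_path_iff
  by (metis le_cases unique_geodesic_def)

lemma unique_geodesic_monitors:
  assumes "unique_geodesic p" "e \<in> path_edges p"
  shows "monitors V E (hd p) (last p) e"
proof -
  have "q = p" if "shortest_path V E (hd p) (last p) q" for q
    using that assms(1) unique_geodesic_shortest_path[OF assms(1)]
    unfolding shortest_path_def is_path_iff unique_geodesic_def by blast
  with assms show ?thesis
    unfolding monitors_def using unique_geodesic_shortest_path by blast
qed

lemma unique_geodesic_edge:
  assumes "u \<sim> v"
  shows "unique_geodesic [u, v]"
proof -
  have "q = [u, v]" if "walk q" "hd q = u" "last q = v" "length q \<le> 2" for q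
    using that assms adj_irrefl by (cases q rule: remdups_adj.cases) (auto simp: walk_def)
  with assms adj_in_V show ?thesis
    by (auto simp: unique_geodesic_def walk_Cons_Cons walk_singleton)
qed

text \<open>Walks from \<open>u\<close> to \<open>x\<close> with one or two vertices are excluded by
  \<open>x \<noteq> u\<close> and by non-adjacency, and the middle vertex of a walk with three
  vertices is forced to be \<open>v\<close>.\<close>

lemma unique_geodesic_two:
  assumes "u \<sim> v" "v \<sim> x" "x \<noteq> u" "\<not> u \<sim> x" "\<And>y. u \<sim> y \<Longrightarrow> y \<sim> x \<Longrightarrow> y = v"
  shows "unique_geodesic [u, v, x]"
proof -
  have "q = [u, v, x]" if "walk q" "hd q = u" "last q = x" "length q \<le> 3" for q
  proof -
    from that(1) obtain a q1 where q: "q = a # q1"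
      by (cases q) (auto simp: walk_def)
    with that assms obtain b q2 where q1: "q1 = b # q2"
      by (cases q1) auto
    with q that assms obtain c q3 where q2: "q2 = c # q3"
      by (cases q2) (auto simp: walk_Cons_Cons)
    with q q1 that(4) have q_eq: "q = [a, b, c]"
      by simp
    with that have "a = u" "c = x" "u \<sim> b" "b \<sim> x"
      by (auto simp: walk_Cons_Cons)
    with assms(5) q_eq show ?thesis
      by simp
  qed
  with assms(1,2) adj_in_V show ?thesis
    by (auto simp: unique_geodesic_def walk_Cons_Cons walk_singleton)
qed

section \<open>Characterization of mandatory vertices by witnesses\<close>

definition mandatory_witness :: "'a \<Rightarrow> 'a \<Rightarrow> bool" where
  "mandatory_witness u v \<longleftrightarrow> u \<sim> v \<and>
     (\<forall>x. v \<sim> x \<longrightarrow> x = u \<or> u \<sim> x \<or> (\<exists>y. y \<noteq> v \<and> u \<sim> y \<and> y \<sim> x))"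

text \<open>An \<open>x\<close> violating the witness condition differs from \<open>u\<close>, is
  not adjacent to \<open>u\<close>, and shares only the neighbour \<open>v\<close> with it, which is
  what \<open>unique_geodesic_two\<close> asks for.\<close>

lemma not_mandatory_witness:
  assumes "u \<sim> v" "\<not> mandatory_witness u v"
  obtains x where "unique_geodesic [u, v, x]"
  using assms unique_geodesic_two unfolding mandatory_witness_def by metis

text \<open>An edge \<open>{u, v}\<close> monitored by vertices other than \<open>v\<close> lies on a shortest path through \<open>v\<close>,
  and a common neighbour of the two path neighbours of \<open>v\<close> yields a detour around \<open>v\<close>.\<close>

lemma mandatory_witness_imp_mem:
  assumes wit: "mandatory_witness u v" and M: "meg_set V E M"
  shows "v \<in> M"
proof (rule ccontr)
  assume v: "v \<notin> M"
  from wit M obtain a b where ab: "a \<in> M" "b \<in> M" "monitors V E a b {u, v}"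
    unfolding mandatory_witness_def meg_set_def by blast
  then obtain p where p: "shortest_path V E a b p" and uv: "{u, v} \<in> path_edges p"
    unfolding monitors_def by blast
  then have walk_p: "walk p" "distinct p" "hd p = a" "last p = b"
    by (auto simp: shortest_path_def is_path_iff)
  \<comment> \<open>The ends of \<open>p\<close> lie in \<open>M\<close> and \<open>v\<close> does
    not, so \<open>v\<close> is an inner vertex of \<open>p\<close>, with path neighbours
    \<open>l\<close> and \<open>r\<close>; the edge on \<open>p\<close> makes \<open>u\<close> one
    of them.\<close>
  have "\<exists>xs l r ys. p = xs @ l # v # r # ys \<and> (u = l \<or> u = r)"
  proof -
    obtain xs s t ys where st: "p = xs @ s # t # ys" "{u, v} = {s, t}"
      using uv unfolding path_edges_iff by blast
    consider "s = u" "t = v" | "s = v" "t = u"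
      using st(2) by (auto simp: doubleton_eq_iff)
    then show ?thesis
    proof cases
      case 1
      then have "ys \<noteq> []"
        using st(1) walk_p v ab by auto
      then show ?thesis
        using 1 st(1) by (cases ys) auto
    next
      case 2
      then have "xs \<noteq> []"
        using st(1) walk_p v ab by auto
      then have "p = butlast xs @ last xs # v # u # ys"
        using 2 st(1) by simp
      then show ?thesis
        by blast
    qed
  qed
  then obtain xs l r ys where p_eq: "p = xs @ l # v # r # ys" and u: "u = l \<or> u = r"
    by blast
  have edges: "l \<sim> v" "v \<sim> r" and walks: "walk (xs @ [l])" "walk (r # ys)"
    using walk_p(1) unfolding p_eq walk_def
    by (auto simp: successively_append_iff successively_Cons)
  have ends: "hd (xs @ [l]) = a" "last (r # ys) = b"
    using walk_p p_eq by (auto simp: hd_append)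
  have "l \<noteq> r"
    using walk_p(2) p_eq by auto
  moreover have "\<not> l \<sim> r"
  proof
    assume "l \<sim> r"
    then have "walk ((xs @ [l]) @ r # ys)"
      using walks by (subst walk_append) auto
    then have "length p \<le> length ((xs @ [l]) @ r # ys)"
      using ends by (intro shortest_path_le_walk[OF p]) (auto simp: hd_append)
    then show False
      by (simp add: p_eq)
  qed
  \<comment> \<open>The witness condition is applied to whichever of \<open>l\<close> and
    \<open>r\<close> is not \<open>u\<close>; the first two alternatives are ruled out because
    \<open>p\<close> is distinct and has no shortcut past \<open>v\<close>.\<close>
  ultimately obtain y where y: "y \<noteq> v" "l \<sim> y" "y \<sim> r"
    using wit u edges adj_sym unfolding mandatory_witness_def by metis
  let ?q = "(xs @ [l]) @ y # r # ys"
  have "walk ?q"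
    using walks y by (subst walk_append) (auto simp: walk_Cons_Cons)
  then have "shortest_path V E a b ?q"
    using ends by (intro shortest_walk_is_shortest_path[OF p]) (auto simp: p_eq hd_append)
  then have "{u, v} \<in> path_edges ?q"
    using ab(3) unfolding monitors_def by blast
  then have "v \<in> set ?q"
    unfolding path_edges_iff by (metis doubleton_eq_iff in_set_conv_decomp append_Cons append_assoc append_Nil)
  moreover have "v \<notin> set ?q"
    using walk_p(2) y(1) by (auto simp: p_eq)
  ultimately show False
    by blast
qed

lemma adj_monitors: "u \<sim> v \<Longrightarrow> monitors V E u v {u, v}"
  using unique_geodesic_monitors[OF unique_geodesic_edge, of u v "{u, v}"]
  by (auto simp: path_edges_iff) (metis append_Nil)

text \<open>If \<open>v\<close> has no witness, \<open>V - {v}\<close> is a meg-set: an edge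
  \<open>{u, v}\<close> is monitored by the ends of a unique geodesic \<open>[u, v, x]\<close>, and
  every edge avoiding \<open>v\<close> by its own ends.\<close>

lemma Mand_iff: "v \<in> Mand V E \<longleftrightarrow> v \<in> V \<and> (\<exists>u. mandatory_witness u v)"
proof
  assume v: "v \<in> Mand V E"
  show "v \<in> V \<and> (\<exists>u. mandatory_witness u v)"
  proof (rule ccontr)
    assume not: "\<not> ?thesis"
    have inc: "\<exists>a\<in>V - {v}. \<exists>b\<in>V - {v}. monitors V E a b {u, v}" if "u \<sim> v" for u
    proof -
      from not v that obtain x where x: "unique_geodesic [u, v, x]"
        using not_mandatory_witness unfolding Mand_def by blast
      then have "monitors V E u x {u, v}"
        using unique_geodesic_monitors[OF x] by (auto simp: path_edges_iff) (metis append_Nil)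
      moreover have "u \<in> V - {v}" "x \<in> V - {v}"
        using x unique_geodesic_distinct[OF x] by (auto simp: unique_geodesic_def walk_def)
      ultimately show ?thesis
        by blast
    qed
    have "meg_set V E (V - {v})"
      unfolding meg_set_def
    proof (intro conjI ballI)
      fix e
      assume "e \<in> E"
      then obtain s t where st: "e = {s, t}" "s \<sim> t"
        by (rule edgeE)
      show "\<exists>a\<in>V - {v}. \<exists>b\<in>V - {v}. monitors V E a b e"
      proof (cases "s = v \<or> t = v")
        case True
        then show ?thesis
          using st inc[of s] inc[of t] adj_sym[of s t] by (auto simp: insert_commute)
      next
        case False
        then show ?thesis
          using st adj_monitors adj_in_V by blast
      qed
    qed auto
    then show False
      using v by (auto simp: Mand_def)
  qed
next
  assume "v \<in> V \<and> (\<exists>u. mandatory_witness u v)"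
  then show "v \<in> Mand V E"
    using mandatory_witness_imp_mem by (auto simp: Mand_def)
qed

section \<open>Chordal graphs\<close>

text \<open>A shortest walk from \<open>c\<close> to another neighbour of \<open>b\<close> closes up with \<open>b\<close> to an induced cycle.\<close>

lemma chordal_common_neighbour:
  assumes ch: "chordal V E" and W: "walk W" "b \<notin> set W" "hd W \<sim> b" "last W \<sim> b" "last W \<noteq> hd W"
  obtains d where "d \<in> set W" "d \<sim> b" "d \<sim> hd W"
proof -
  \<comment> \<open>The walk may end in any neighbour of \<open>b\<close> other than
    \<open>hd W\<close>, not only in \<open>last W\<close>; therefore a shortest good walk has no
    neighbour of \<open>b\<close> in its interior. Staying inside \<open>W\<close> keeps it away
    from \<open>b\<close>.\<close>
  define good where "good w \<longleftrightarrow> walk w \<and> hd w = hd W \<and> set w \<subseteq> set W \<and>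
    last w \<sim> b \<and> last w \<noteq> hd W" for w
  have "good W"
    using W by (simp add: good_def)
  then obtain w where w: "good w" and min: "\<And>w'. good w' \<Longrightarrow> length w \<le> length w'"
    using ex_has_least_nat[of good W length] by blast
  have ne: "w \<noteq> []"
    using w by (simp add: good_def walk_def)
  have dist: "distinct w"
    using walk_shorten[of w] w min unfolding good_def by (metis leD order_trans)
  have b: "b \<notin> set w"
    using w W(2) by (auto simp: good_def)
  have no_b: "\<not> w ! j \<sim> b" if "0 < j" "Suc j < length w" for j
  proof
    assume *: "w ! j \<sim> b"
    have last: "last (take (Suc j) w) = w ! j"
      using that by (simp add: take_Suc_conv_app_nth)
    have "w ! j \<noteq> hd W"
      using that nth_eq_iff_index_eq[OF dist, of j 0] w ne by (auto simp: good_def hd_conv_nth)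
    moreover have "walk (take (Suc j) w)"
      using w ne that walk_append[of "take (Suc j) w" "drop (Suc j) w"] by (auto simp: good_def)
    ultimately have "good (take (Suc j) w)"
      using w that * ne last set_take_subset[of "Suc j" w] by (auto simp: good_def)
    from min[OF this] that show False
      by simp
  qed
  \<comment> \<open>A chord would allow a shorter good walk with the same ends.\<close>
  have no_chord: "\<not> w ! i \<sim> w ! j" if "Suc i < j" "j < length w" for i j
  proof
    assume *: "w ! i \<sim> w ! j"
    let ?q = "take (Suc i) w @ drop j w"
    have "walk (take (Suc i) w)" "walk (drop j w)"
      using w ne that walk_append[of "take (Suc i) w" "drop (Suc i) w"]
        walk_append[of "take j w" "drop j w"] by (auto simp: good_def)
    then have "walk ?q"
      using that * ne
      by (subst walk_append) (auto simp: hd_drop_conv_nth take_Suc_conv_app_nth)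
    then have "good ?q"
      using w that ne set_take_subset[of "Suc i" w] set_drop_subset[of j w]
      by (auto simp: good_def hd_append)
    from min[OF this] that show False
      by simp
  qed
  \<comment> \<open>With three or more vertices, \<open>b # w\<close> would be an induced cycle of
    length at least 4.\<close>
  have "length w \<le> 2"
  proof (rule ccontr)
    assume long: "\<not> ?thesis"
    have step: "w ! i \<sim> w ! Suc i" if "Suc i < length w" for i
      using w that by (auto simp: good_def walk_def successively_conv_nth)
    have "induced_cycle V E (b # w)"
      unfolding induced_cycle_def
    proof (intro conjI allI impI)
      show "3 \<le> length (b # w)" "distinct (b # w)"
        using long dist b by auto
      show "set (b # w) \<subseteq> V"
        using w adj_in_V by (auto simp: good_def walk_def)
      fix i j
      assume ij: "i < j \<and> j < length (b # w)"
      then obtain j' where j: "j = Suc j'" "j' < length w"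
        by (cases j) auto
      show "{(b # w) ! i, (b # w) ! j} \<in> E \<longleftrightarrow> j = Suc i \<or> (i = 0 \<and> Suc j = length (b # w))"
      proof (cases i)
        case 0
        have "w ! 0 \<sim> b" "w ! (length w - 1) \<sim> b"
          using w W(3) ne by (auto simp: good_def hd_conv_nth last_conv_nth)
        moreover have "j' = 0 \<or> j' = length w - 1 \<or> (0 < j' \<and> Suc j' < length w)"
          using j by arith
        ultimately show ?thesis
          using 0 j no_b[of j'] ne by (auto simp: insert_commute)
      next
        case (Suc i')
        then show ?thesis
          using j ij no_chord[of i' j'] step[of i'] by (cases "j' = Suc i'") auto
      qed
    qed
    moreover have "4 \<le> length (b # w)"
      using long by simp
    ultimately show False
      using ch by (auto simp: chordal_def)
  qed
  then obtain d where "w = [hd W, d]"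
    using w ne by (cases w rule: remdups_adj.cases) (auto simp: good_def)
  with w that[of d] show thesis
    by (auto simp: good_def walk_Cons_Cons insert_commute)
qed

text \<open>Suppose \<open>q\<close> rivals the prolonged walk. It avoids \<open>b\<close>, so
  following \<open>c # r\<close> to its end and \<open>q\<close> back to \<open>a\<close> joins two
  neighbours of \<open>b\<close> without meeting \<open>b\<close>. Chordality gives a common
  neighbour \<open>d\<close> of \<open>b\<close> and \<open>c\<close> on this walk. If
  \<open>d\<close> lies on \<open>r\<close>, the part of \<open>r\<close> after \<open>d\<close> is
  too short for the uniqueness of \<open>b # c # r\<close>. If \<open>d\<close> lies on
  \<open>q\<close>, it is so close to \<open>a\<close> that \<open>[a, c]\<close> or
  \<open>[a, d, c]\<close> rivals \<open>[a, b, c]\<close>.\<close>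

lemma unique_geodesic_Cons:
  assumes ch: "chordal V E" and abc: "unique_geodesic [a, b, c]"
    and geo: "unique_geodesic (b # c # r)"
  shows "unique_geodesic (a # b # c # r)"
proof (rule ccontr)
  assume not: "\<not> ?thesis"
  have edges: "a \<sim> b" "b \<sim> c" and walk_cr: "walk (c # r)" and walk_bcr: "walk (b # c # r)"
    using abc geo by (auto simp: unique_geodesic_def walk_Cons_Cons)
  have dist_abc: "distinct [a, b, c]" and dist: "distinct (b # c # r)"
    using unique_geodesic_distinct abc geo by blast+
  define z where "z = last (c # r)"
  obtain q where q: "walk q" "hd q = a" "last q = z" "length q \<le> length r + 3"
    "q \<noteq> a # b # c # r"
    using not edges walk_bcr unfolding unique_geodesic_def z_def by (auto simp: walk_Cons_Cons)
  have q_ne: "q \<noteq> []"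
    using q(1) by (simp add: walk_def)
  \<comment> \<open>From \<open>b\<close> on, \<open>q\<close> is no longer than
    \<open>b # c # r\<close> and therefore equals it, which leaves only \<open>a\<close> in front
    and makes \<open>q\<close> the walk it was to differ from.\<close>
  have b_q: "b \<notin> set q"
  proof
    assume "b \<in> set q"
    then obtain q1 q2 where split: "q = q1 @ b # q2"
      by (auto simp: in_set_conv_decomp)
    have q1: "q1 \<noteq> []"
      using q(2) dist_abc split by auto
    have "walk (b # q2)"
      using q(1) q1 by (simp add: split walk_append)
    moreover have "length (b # q2) \<le> length (b # c # r)"
      using q(4) q1 by (cases q1) (auto simp: split)
    ultimately have "b # q2 = b # c # r"
      using q(3) split z_def by (intro unique_geodesicD[OF geo]) auto
    moreover from this have "q1 = [a]"
      using q(2,4) q1 split by (cases q1) auto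
    ultimately show False
      using q(5) split by simp
  qed
  \<comment> \<open>Both pieces contain the common end \<open>z\<close>; \<open>tl\<close> drops the
    second copy.\<close>
  define W where "W = (c # r) @ tl (rev q)"
  have last_q: "rev q = z # tl (rev q)"
    using q(3) q_ne by (metis hd_rev list.collapse rev_is_Nil_conv)
  have walk_W: "walk W"
  proof (cases "tl (rev q)")
    case Nil
    then show ?thesis
      using walk_cr by (simp add: W_def)
  next
    case (Cons y ys)
    have "walk (z # y # ys)"
      using last_q Cons q(1) walk_rev by metis
    then show ?thesis
      using walk_cr z_def Cons unfolding W_def by (simp add: walk_append[of "c # r"] walk_Cons_Cons del: append_Cons)
  qed
  have set_W: "set W \<subseteq> set (c # r) \<union> set q"
    using q_ne by (auto simp: W_def dest: list.set_sel(2)[rotated])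
  have hd_W: "hd W = c"
    by (simp add: W_def)
  have last_W: "last W = a"
  proof (cases "tl (rev q)")
    case Nil
    then have "q = [z]"
      using last_q by simp
    then show ?thesis
      using q(2) Nil by (simp add: W_def z_def)
  next
    case (Cons y ys)
    then have "last W = last (rev q)"
      using last_q by (metis W_def last_ConsR last_appendR list.distinct(1))
    then show ?thesis
      using q(2) q_ne by (simp add: last_rev)
  qed
  have b_W: "b \<notin> set W"
    using set_W b_q dist by auto
  obtain d where d: "d \<in> set W" "d \<sim> b" "d \<sim> c"
    using chordal_common_neighbour[OF ch walk_W b_W] hd_W last_W edges dist_abc
    by (metis adj_sym distinct_length_2_or_more)
  have dc: "d \<noteq> c" and bd: "d \<noteq> b"
    using d b_W adj_irrefl by auto
  \<comment> \<open>Otherwise \<open>b # d # s\<close> would rival \<open>b # c # r\<close>.\<close>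
  have shortcut: "length s > length r" if "walk (d # s)" "last (d # s) = z" for s
  proof (rule ccontr)
    assume "\<not> ?thesis"
    then have "b # d # s = b # c # r"
      using that d by (intro unique_geodesicD[OF geo]) (auto simp: walk_Cons_Cons z_def insert_commute)
    with dc show False
      by simp
  qed
  consider "d \<in> set r" | "d \<in> set q"
    using d(1) set_W dc by auto
  then show False
  proof cases
    case 1
    then obtain r1 r2 where r: "r = r1 @ d # r2"
      by (auto simp: in_set_conv_decomp)
    have "walk (d # r2)"
      using walk_cr walk_append[of "c # r1" "d # r2"] by (simp add: r)
    then show False
      using shortcut[of r2] by (simp add: r z_def)
  next
    case 2
    then obtain q1 q2 where split: "q = q1 @ d # q2"
      by (auto simp: in_set_conv_decomp)
    have "walk (d # q2)"
      using q(1) walk_append[of q1 "d # q2"] by (cases "q1 = []") (auto simp: split)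
    then have "length r < length q2"
      using shortcut[of q2] q(3) by (simp add: split)
    \<comment> \<open>At least \<open>length r + 2\<close> of the at most
      \<open>length r + 3\<close> vertices of \<open>q\<close> are \<open>d\<close> and those after
      it.\<close>
    then have "length q1 \<le> 1"
      using q(4) by (simp add: split)
    then consider "q1 = []" | "q1 = [a]"
      using q(2) by (cases q1) (auto simp: split)
    then show False
    proof cases
      case 1
      then have "walk [a, c]"
        using d(3) q(2) split adj_in_V by (auto simp: walk_Cons_Cons walk_singleton)
      then show False
        using unique_geodesicD[OF abc, of "[a, c]"] by simp
    next
      case 2
      then have "a \<sim> d"
        using q(1) split by (simp add: walk_Cons_Cons)
      then have "walk [a, d, c]"
        using d(3) adj_in_V by (auto simp: walk_Cons_Cons walk_singleton)
      then show False
        using unique_geodesicD[OF abc, of "[a, d, c]"] bd by simp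
    qed
  qed
qed

text \<open>As \<open>u\<close> is not mandatory, its neighbour \<open>v\<close> is no witness for
  it. This yields a unique geodesic \<open>[v, u, x]\<close>, whose reverse is glued to the
  front.\<close>

lemma unique_geodesic_extend_hd:
  assumes ch: "chordal V E" and geo: "unique_geodesic (u # v # r)" and u: "u \<notin> Mand V E"
  obtains x where "unique_geodesic (x # u # v # r)"
proof -
  have "v \<sim> u" "u \<in> V"
    using geo adj_in_V by (auto simp: unique_geodesic_def walk_Cons_Cons insert_commute)
  with u obtain x where "unique_geodesic [v, u, x]"
    using not_mandatory_witness Mand_iff by blast
  then have "unique_geodesic [x, u, v]"
    using unique_geodesic_rev by fastforce
  with unique_geodesic_Cons[OF ch _ geo] that show thesis
    by blast
qed

lemma path_edges_rev: "path_edges (rev p) = path_edges (p :: 'a list)"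
proof -
  have "path_edges (rev p) \<subseteq> path_edges p" for p :: "'a list"
  proof
    fix e
    assume "e \<in> path_edges (rev p)"
    then obtain xs u v ys where "rev p = xs @ u # v # ys" "e = {u, v}"
      by (auto simp: path_edges_iff)
    then have "p = rev ys @ v # u # rev xs" "e = {v, u}"
      by (auto simp: rev_swap)
    then show "e \<in> path_edges p"
      unfolding path_edges_iff by blast
  qed
  from this[of p] this[of "rev p"] show ?thesis
    by simp
qed

text \<open>A longest unique geodesic through \<open>e\<close> cannot be prolonged, so both of its
  ends are mandatory.\<close>

lemma chordal_Mand_meg_set:
  assumes ch: "chordal V E"
  shows "meg_set V E (Mand V E)"
  unfolding meg_set_def
proof (intro conjI ballI)
  show "Mand V E \<subseteq> V"
    by (auto simp: Mand_def)
next
  fix e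
  assume "e \<in> E"
  then obtain u v where e: "e = {u, v}" "u \<sim> v"
    by (rule edgeE)
  define good where "good p \<longleftrightarrow> unique_geodesic p \<and> e \<in> path_edges p" for p
  have "good [u, v]"
    using e unique_geodesic_edge unfolding good_def path_edges_iff by (metis append_Nil)
  \<comment> \<open>Unique geodesics are distinct, so their lengths are bounded and a longest one
    exists.\<close>
  moreover have "length p < Suc (card V)" if "good p" for p
  proof -
    have "distinct p" "set p \<subseteq> V"
      using that unique_geodesic_distinct by (auto simp: good_def unique_geodesic_def walk_def)
    then show ?thesis
      using card_mono[OF finite_V] distinct_card by (metis less_Suc_eq_le)
  qed
  ultimately obtain p where p: "good p" and max: "\<And>p'. good p' \<Longrightarrow> length p' \<le> length p"
    using ex_has_greatest_nat[of good _ length] by (metis less_imp_le)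
  \<comment> \<open>Stated for every good walk of maximal length, so that applying it to
    \<open>rev p\<close> settles the last vertex of \<open>p\<close>.\<close>
  have hd_Mand: "hd p' \<in> Mand V E" if p': "good p'" "length p' = length p" for p'
  proof (rule ccontr)
    assume not: "hd p' \<notin> Mand V E"
    have "Suc (Suc 0) \<le> length p'"
      using p' by (auto simp: good_def path_edges_iff)
    then obtain s t r where p'_eq: "p' = s # t # r"
      by (auto simp: Suc_le_length_iff)
    then obtain x where x: "unique_geodesic (x # p')"
      using unique_geodesic_extend_hd[OF ch, of s t r] p' not by (auto simp: good_def)
    have "e \<in> path_edges (x # p')"
      using p' unfolding good_def path_edges_iff by (metis append_Cons)
    with x max[of "x # p'"] p' show False
      by (simp add: good_def)
  qed
  have "good (rev p)"
    using p unique_geodesic_rev by (simp add: good_def path_edges_rev)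
  then have "hd p \<in> Mand V E" "last p \<in> Mand V E"
    using hd_Mand[OF p] hd_Mand[of "rev p"] by (simp_all add: hd_rev)
  then show "\<exists>a\<in>Mand V E. \<exists>b\<in>Mand V E. monitors V E a b e"
    using p unique_geodesic_monitors by (auto simp: good_def)
qed

text \<open>Every meg-set contains the mandatory vertices, so they form the smallest meg-set as soon
  as they form one at all.\<close>

lemma chordal_minimum_meg_set:
  assumes "chordal V E"
  shows "minimum_meg_set V E (Mand V E)"
  unfolding minimum_meg_set_def
proof (intro conjI allI impI)
  show "meg_set V E (Mand V E)"
    using chordal_Mand_meg_set[OF assms] .
  fix M
  assume "meg_set V E M"
  then show "card (Mand V E) \<le> card M"
    using finite_V by (intro card_mono) (auto simp: Mand_def meg_set_def intro: finite_subset)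
qed

end

section \<open>Time-bounded weakest preconditions\<close>

text \<open>The second argument of the postcondition is the part of the time budget \<open>T\<close> that is left.\<close>

definition wp :: "nat \<Rightarrow> com \<Rightarrow> state \<Rightarrow> nat \<Rightarrow> (state \<Rightarrow> nat \<Rightarrow> bool) \<Rightarrow> bool" where
  "wp w c s T Q \<longleftrightarrow> (\<exists>t s'. exec w c s t s' \<and> t \<le> T \<and> Q s' (T - t))"

inductive_cases exec_SkipE: "exec w Skip s t s'"
inductive_cases exec_SetE: "exec w (Set x e) s t s'"
inductive_cases exec_SetArrE: "exec w (SetArr a i e) s t s'"
inductive_cases exec_SeqE: "exec w (Seq c d) s t s'"
inductive_cases exec_CondE: "exec w (Cond b c d) s t s'"

lemma wp_Skip: "wp w Skip s T Q \<longleftrightarrow> 1 \<le> T \<and> Q s (T - 1)"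
  unfolding wp_def by (metis exec_SkipE exec.Skip)

lemma wp_Set:
  "wp w (Set x e) (r, m) T Q \<longleftrightarrow> exp_val e (r, m) \<le> w \<and> exp_cost e + 1 \<le> T \<and>
     Q (r(x := exp_val e (r, m)), m) (T - (exp_cost e + 1))"
  unfolding wp_def by (metis exec_SetE exec.Set Pair_inject)

lemma wp_SetArr:
  "wp w (SetArr a i e) (r, m) T Q \<longleftrightarrow> exp_val i (r, m) \<le> w \<and> exp_val e (r, m) \<le> w \<and>
     exp_cost i + exp_cost e + 1 \<le> T \<and>
     Q (r, m(a := (m a)(exp_val i (r, m) := exp_val e (r, m)))) (T - (exp_cost i + exp_cost e + 1))"
  unfolding wp_def
proof (intro iffI; elim exE conjE)
  fix t s'
  assume "exec w (SetArr a i e) (r, m) t s'" "t \<le> T" "Q s' (T - t)"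
  then show "exp_val i (r, m) \<le> w \<and> exp_val e (r, m) \<le> w \<and>
     exp_cost i + exp_cost e + 1 \<le> T \<and>
     Q (r, m(a := (m a)(exp_val i (r, m) := exp_val e (r, m)))) (T - (exp_cost i + exp_cost e + 1))"
    by (elim exec_SetArrE) simp
next
  assume "exp_val i (r, m) \<le> w" "exp_val e (r, m) \<le> w" "exp_cost i + exp_cost e + 1 \<le> T"
    and "Q (r, m(a := (m a)(exp_val i (r, m) := exp_val e (r, m)))) (T - (exp_cost i + exp_cost e + 1))"
  then show "\<exists>t s'. exec w (SetArr a i e) (r, m) t s' \<and> t \<le> T \<and> Q s' (T - t)"
    using exec.SetArr[of i r m w e a] by blast
qed

lemma wp_Seq: "wp w (Seq c d) s T Q \<longleftrightarrow> wp w c s T (\<lambda>s' T'. wp w d s' T' Q)"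
proof
  assume "wp w (Seq c d) s T Q"
  then obtain t s' t' s'' where "exec w c s t s'" "exec w d s' t' s''" "t + t' \<le> T"
    "Q s'' (T - (t + t'))"
    unfolding wp_def by (blast elim: exec_SeqE)
  then show "wp w c s T (\<lambda>s' T'. wp w d s' T' Q)"
    unfolding wp_def by (intro exI[of _ t] exI[of _ s'] conjI exI[of _ t'] exI[of _ s'']) auto
next
  assume "wp w c s T (\<lambda>s' T'. wp w d s' T' Q)"
  then obtain t s' t' s'' where "exec w c s t s'" "exec w d s' t' s''" "t \<le> T" "t' \<le> T - t"
    "Q s'' (T - t - t')"
    unfolding wp_def by blast
  then show "wp w (Seq c d) s T Q"
    unfolding wp_def by (intro exI[of _ "t + t'"] exI[of _ s'']) (auto intro: exec.Seq)
qed

lemma wp_Cond: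
  "wp w (Cond b c d) s T Q \<longleftrightarrow> test_cost b + 1 \<le> T \<and>
     (if test_val b s then wp w c s (T - (test_cost b + 1)) Q
      else wp w d s (T - (test_cost b + 1)) Q)"
proof
  assume "wp w (Cond b c d) s T Q"
  then obtain t s' where ex: "exec w (Cond b c d) s t s'" and t: "t \<le> T" and Q: "Q s' (T - t)"
    unfolding wp_def by blast
  from ex obtain t' where "t = test_cost b + 1 + t'"
    "if test_val b s then exec w c s t' s' else exec w d s t' s'"
    by (rule exec_CondE) auto
  with t Q show "test_cost b + 1 \<le> T \<and>
     (if test_val b s then wp w c s (T - (test_cost b + 1)) Q
      else wp w d s (T - (test_cost b + 1)) Q)"
    unfolding wp_def by (auto split: if_splits simp del: split_paired_Ex
        intro!: exI[of _ t'] exI[of _ s'])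
next
  assume *: "test_cost b + 1 \<le> T \<and>
     (if test_val b s then wp w c s (T - (test_cost b + 1)) Q
      else wp w d s (T - (test_cost b + 1)) Q)"
  then obtain t s' where "if test_val b s then exec w c s t s' else exec w d s t s'"
    and t: "t \<le> T - (test_cost b + 1)" and Q: "Q s' (T - (test_cost b + 1) - t)"
    unfolding wp_def by (auto split: if_splits)
  then have "exec w (Cond b c d) s (test_cost b + 1 + t) s'"
    using exec.CondTrue[of b s w c t s' d] exec.CondFalse[of b s w d t s' c] by (auto split: if_splits)
  then have "exec w (Cond b c d) s (test_cost b + 1 + t) s' \<and> test_cost b + 1 + t \<le> T"
    using * t by linarith
  with Q show "wp w (Cond b c d) s T Q"
    unfolding wp_def by (intro exI[of _ "test_cost b + 1 + t"] exI[of _ s']) (simp only: diff_diff_left)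
qed

text \<open>As rewrite rules, these equivalences execute loop-free code symbolically and leave only
  the arithmetic of the budget.\<close>

lemmas wp_simps = wp_Skip wp_Set wp_SetArr wp_Seq wp_Cond

definition for_loop :: "string \<Rightarrow> exp \<Rightarrow> com \<Rightarrow> com" where
  "for_loop x e c =
     Seq (Set x (Const 0))
       (While (Less (Reg x) e) (Seq c (Set x (Plus (Reg x) (Const 1)))))"

lemma wp_for_loop:
  assumes init: "I 0 (r(x := 0)) m"
    and bound: "\<And>i r m. i \<le> N \<Longrightarrow> r x = i \<Longrightarrow> I i r m \<Longrightarrow> exp_val e (r, m) = N"
    and body: "\<And>i r m. i < N \<Longrightarrow> r x = i \<Longrightarrow> I i r m \<Longrightarrow>
      wp w c (r, m) K (\<lambda>(r', m') _. r' x = i \<and> I (Suc i) (r'(x := Suc i)) m')"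
    and w: "N \<le> w"
    and time: "N * (K + exp_cost e + 7) + exp_cost e + 5 \<le> T"
    and post: "\<And>r' m' T'. r' x = N \<Longrightarrow> I N r' m' \<Longrightarrow>
      T \<le> T' + (N * (K + exp_cost e + 7) + exp_cost e + 5) \<Longrightarrow> Q (r', m') T'"
  shows "wp w (for_loop x e c) (r, m) T Q"
proof -
  let ?loop = "While (Less (Reg x) e) (Seq c (Set x (Plus (Reg x) (Const 1))))"
  have loop: "\<exists>t r' m'. exec w ?loop (r, m) t (r', m') \<and> r' x = N \<and> I N r' m' \<and>
      t \<le> (N - i) * (K + exp_cost e + 7) + exp_cost e + 3"
    if "i \<le> N" "r x = i" "I i r m" for i r m
    using that
  proof (induction "N - i" arbitrary: i r m)
    case 0
    then have "exp_val e (r, m) = N" "i = N"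
      using bound[of i r m] by auto
    with 0 have "exec w ?loop (r, m) (test_cost (Less (Reg x) e) + 1) (r, m)"
      by (intro exec.WhileFalse) simp
    with 0 show ?case
      by (intro exI conjI) auto
  next
    case (Suc l)
    then have i: "i < N"
      by simp
    from body[OF this Suc.prems(2,3)] obtain t r' m' where
      t: "exec w c (r, m) t (r', m')" "t \<le> K" "r' x = i" "I (Suc i) (r'(x := Suc i)) m'"
      unfolding wp_def by auto
    have "exec w (Set x (Plus (Reg x) (Const 1))) (r', m') 4 (r'(x := Suc i), m')"
      using exec.Set[of "Plus (Reg x) (Const 1)" r' m' w x] t(3) i w
      by (simp add: numeral_eq_Suc)
    with t(1) have step: "exec w (Seq c (Set x (Plus (Reg x) (Const 1)))) (r, m) (t + 4) (r'(x := Suc i), m')"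
      by (rule exec.Seq)
    have "l = N - Suc i" "Suc i \<le> N"
      using Suc.hyps(2) i by auto
    from Suc.hyps(1)[OF this _ t(4)] obtain t' r'' m'' where
      t': "exec w ?loop (r'(x := Suc i), m') t' (r'', m'')" "r'' x = N" "I N r'' m''"
      "t' \<le> (N - Suc i) * (K + exp_cost e + 7) + exp_cost e + 3"
      by auto
    have "exec w ?loop (r, m) (test_cost (Less (Reg x) e) + 1 + (t + 4) + t') (r'', m'')"
      using step t'(1) bound[OF Suc.prems] Suc.prems(2) i by (intro exec.WhileTrue) auto
    moreover have "N - i = Suc (N - Suc i)"
      using i by simp
    ultimately show ?case
      using t(2) t'(2-4) by (intro exI conjI) auto
  qed
  have set0: "exec w (Set x (Const 0)) (r, m) 2 (r(x := 0), m)"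
    using exec.Set[of "Const 0" r m w x] by (simp add: numeral_2_eq_2)
  obtain t r' m' where
    t: "exec w ?loop (r(x := 0), m) t (r', m')" "r' x = N" "I N r' m'"
    "t \<le> N * (K + exp_cost e + 7) + exp_cost e + 3"
    using loop[of 0 "r(x := 0)" m] init by auto
  have "exec w (for_loop x e c) (r, m) (2 + t) (r', m')"
    unfolding for_loop_def using set0 t(1) by (rule exec.Seq)
  moreover have "Q (r', m') (T - (2 + t))"
    using t time by (intro post) auto
  ultimately show ?thesis
    unfolding wp_def using t(4) time by (intro exI[of _ "2 + t"] exI[of _ "(r', m')"]) auto
qed

section \<open>The program\<close>

text \<open>Entry \<open>v\<close> of array \<open>d\<close> is the degree of \<open>v\<close>, and entry \<open>v\<close> of array \<open>b\<close> is the
  offset \<open>v * n\<close> of its neighbour list in array \<open>L\<close>, saved because the machine cannot multiply.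
  Array \<open>D\<close> is the matrix of common neighbour counts.\<close>

definition list_body :: com where
  "list_body =
     Cond (Equal (Arr ''A'' (Plus (Reg ''k'') (Reg ''u''))) (Const 1))
       (Seq (SetArr ''L'' (Plus (Reg ''k'') (Arr ''d'' (Reg ''v''))) (Reg ''u''))
            (SetArr ''d'' (Reg ''v'') (Plus (Arr ''d'' (Reg ''v'')) (Const 1))))
       Skip"

definition list_row :: com where
  "list_row =
     Seq (SetArr ''b'' (Reg ''v'') (Reg ''k''))
    (Seq (for_loop ''u'' (Reg ''n'') list_body)
         (Set ''k'' (Plus (Reg ''k'') (Reg ''n''))))"

text \<open>With \<open>k\<close> as the offset of row \<open>u\<close>, entry \<open>(u, x)\<close>
  of \<open>D\<close> grows by one for every walk \<open>u, y, x\<close>.\<close>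

definition count_body :: com where
  "count_body =
     Seq (Set ''x'' (Arr ''L'' (Plus (Arr ''b'' (Reg ''y'')) (Reg ''j''))))
         (SetArr ''D'' (Plus (Reg ''k'') (Reg ''x''))
           (Plus (Arr ''D'' (Plus (Reg ''k'') (Reg ''x''))) (Const 1)))"

definition count_row :: com where
  "count_row =
     Seq (Set ''y'' (Arr ''L'' (Plus (Reg ''k'') (Reg ''i''))))
         (for_loop ''j'' (Arr ''d'' (Reg ''y'')) count_body)"

text \<open>The flag \<open>f\<close> survives iff no neighbour \<open>x\<close> of \<open>v\<close>
  refutes that \<open>u\<close> is a witness for \<open>v\<close>. Nested branches stand for a
  conjunction of tests.\<close>

definition check_body :: com where
  "check_body =
     Seq (Set ''x'' (Arr ''L'' (Plus (Arr ''b'' (Reg ''v'')) (Reg ''j''))))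
         (Cond (Less (Arr ''D'' (Plus (Reg ''k'') (Reg ''x''))) (Const 2))
           (Cond (Less (Arr ''A'' (Plus (Reg ''k'') (Reg ''x''))) (Const 1))
             (Cond (Equal (Reg ''x'') (Reg ''u'')) Skip (Set ''f'' (Const 0)))
             Skip)
           Skip)"

definition check_row :: com where
  "check_row =
     Seq (Set ''v'' (Arr ''L'' (Plus (Reg ''k'') (Reg ''i''))))
    (Seq (Set ''f'' (Const 1))
    (Seq (for_loop ''j'' (Arr ''d'' (Reg ''v'')) check_body)
         (Cond (Equal (Reg ''f'') (Const 1)) (SetArr ''S'' (Reg ''v'') (Const 1)) Skip)))"

text \<open>Each \<open>u\<close> counts in its own row of \<open>D\<close>, which is initially
  zero, so nothing has to be cleared between vertices.\<close>

definition vertex_body :: com where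
  "vertex_body =
     Seq (Set ''k'' (Arr ''b'' (Reg ''u'')))
    (Seq (for_loop ''i'' (Arr ''d'' (Reg ''u'')) count_row)
         (for_loop ''i'' (Arr ''d'' (Reg ''u'')) check_row))"

definition mand_program :: com where
  "mand_program =
     Seq (for_loop ''v'' (Reg ''n'') list_row)
         (for_loop ''u'' (Reg ''n'') vertex_body)"

lemma distinct_count_list: "distinct xs \<Longrightarrow> count_list xs x = (if x \<in> set xs then 1 else 0)"
  by (induction xs) auto

section \<open>Construction of the neighbour lists\<close>

locale mand_run = sgraph "{..<n}" E for n :: nat and E +
  fixes w \<Delta> :: nat
  assumes word: "n * n + n + 2 \<le> w"
    and degree_le: "\<And>v. v < n \<Longrightarrow> length (filter (\<lambda>u. v \<sim> u) [0..<n]) \<le> \<Delta>"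
begin

abbreviation nbs_below :: "nat \<Rightarrow> nat \<Rightarrow> nat list" where
  "nbs_below u v \<equiv> filter (\<lambda>x. v \<sim> x) [0..<u]"

definition nbs :: "nat \<Rightarrow> nat list" where
  "nbs v = nbs_below n v"

lemma set_nbs: "set (nbs v) = {u. v \<sim> u}"
  using adj_in_V by (fastforce simp: nbs_def)

lemma distinct_nbs: "distinct (nbs v)"
  by (simp add: nbs_def)

lemma length_nbs_below: "length (nbs_below u v) \<le> u"
  using length_filter_le[of "\<lambda>x. v \<sim> x" "[0..<u]"] by simp

lemma length_nbs: "length (nbs v) \<le> n" "v < n \<Longrightarrow> length (nbs v) \<le> \<Delta>"
  unfolding nbs_def using length_nbs_below degree_le by auto

lemma nth_nbs: "i < length (nbs v) \<Longrightarrow> nbs v ! i < n"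
  using nth_mem[of i "nbs v"] by (auto simp: nbs_def simp del: nth_mem)

lemma row_less: "v' < v \<Longrightarrow> i < n \<Longrightarrow> v' * n + i < v * n"
proof -
  assume "v' < v" "i < n"
  then have "Suc v' * n \<le> v * n"
    by (intro mult_le_mono1) simp
  with \<open>i < n\<close> show ?thesis
    by simp
qed

definition matrix_input :: "(string \<Rightarrow> nat) \<Rightarrow> (string \<Rightarrow> nat \<Rightarrow> nat) \<Rightarrow> bool" where
  "matrix_input r m \<longleftrightarrow> r ''n'' = n \<and>
     (\<forall>v<n. \<forall>u<n. m ''A'' (v * n + u) = (if v \<sim> u then 1 else 0))"

definition rows :: "(string \<Rightarrow> nat \<Rightarrow> nat) \<Rightarrow> nat \<Rightarrow> bool" where
  "rows m v \<longleftrightarrow> (\<forall>v'<v. m ''b'' v' = v' * n \<and> m ''d'' v' = length (nbs v') \<and>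
     (\<forall>i<length (nbs v'). m ''L'' (v' * n + i) = nbs v' ! i))"

text \<open>The last three conjuncts preserve initial zeros: \<open>d\<close> serves as insertion
  position, and \<open>D\<close> and \<open>S\<close> are filled only in the second phase.\<close>

definition list_row_inv :: "nat \<Rightarrow> (string \<Rightarrow> nat) \<Rightarrow> (string \<Rightarrow> nat \<Rightarrow> nat) \<Rightarrow> bool" where
  "list_row_inv v r m \<longleftrightarrow> matrix_input r m \<and> r ''k'' = v * n \<and> rows m v \<and>
     (\<forall>v'\<ge>v. m ''d'' v' = 0) \<and> m ''D'' = (\<lambda>_. 0) \<and> m ''S'' = (\<lambda>_. 0)"

definition list_inv :: "nat \<Rightarrow> nat \<Rightarrow> (string \<Rightarrow> nat) \<Rightarrow> (string \<Rightarrow> nat \<Rightarrow> nat) \<Rightarrow> bool" where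
  "list_inv v u r m \<longleftrightarrow> matrix_input r m \<and> r ''k'' = v * n \<and> r ''v'' = v \<and> rows m v \<and>
     m ''b'' v = v * n \<and> m ''d'' v = length (nbs_below u v) \<and>
     (\<forall>i<length (nbs_below u v). m ''L'' (v * n + i) = nbs_below u v ! i) \<and>
     (\<forall>v'>v. m ''d'' v' = 0) \<and> m ''D'' = (\<lambda>_. 0) \<and> m ''S'' = (\<lambda>_. 0)"

lemma row_le_word: "v < n \<Longrightarrow> i \<le> n \<Longrightarrow> v * n + i \<le> w"
  using mult_le_mono1[of v n n] word by linarith

text \<open>Writes concern entry \<open>v\<close> or addresses from \<open>v * n\<close> on, whereas
  the lists of smaller vertices end below \<open>v * n\<close>.\<close>

lemma rows_upd:
  assumes "rows m v" "m' ''b'' = m ''b'' \<or> (\<exists>c. m' ''b'' = (m ''b'')(v := c))"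
    "m' ''d'' = m ''d'' \<or> (\<exists>c. m' ''d'' = (m ''d'')(v := c))"
    "m' ''L'' = m ''L'' \<or> (\<exists>i c. m' ''L'' = (m ''L'')(v * n + i := c))"
  shows "rows m' v"
  unfolding rows_def
proof (intro allI impI conjI)
  fix v'
  assume v': "v' < v"
  show "m' ''b'' v' = v' * n" "m' ''d'' v' = length (nbs v')"
    using assms v' by (auto simp: rows_def)
  fix i
  assume i: "i < length (nbs v')"
  then have "v' * n + i < v * n"
    using row_less[OF v', of i] length_nbs(1)[of v'] by simp
  then show "m' ''L'' (v' * n + i) = nbs v' ! i"
    using assms(1,4) v' i by (auto simp: rows_def)
qed

text \<open>The budget is 7 for the test and 6 for each of the two writes.\<close>

lemma wp_list_body:
  assumes v: "v < n" and u: "u < n" "r ''u'' = u" and inv: "list_inv v u r m"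
  shows "wp w list_body (r, m) 19
    (\<lambda>(r', m') _. r' ''u'' = u \<and> list_inv v (Suc u) (r'(''u'' := Suc u)) m')"
proof -
  note l = length_nbs_below[of v u]
  have le: "v * n + length (nbs_below u v) \<le> w"
    using row_le_word[OF v] l u by simp
  have A: "m ''A'' (v * n + u) = (if v \<sim> u then 1 else 0)"
    using inv v u by (auto simp: list_inv_def matrix_input_def)
  have small: "Suc (length (nbs_below u v)) \<le> w" "u \<le> w" "v \<le> w"
    using l u v word by auto
  show ?thesis
  proof (cases "v \<sim> u")
    case True
    have rows': "rows (m(''L'' := (m ''L'')(v * n + length (nbs_below u v) := u),
         ''d'' := (m ''d'')(v := Suc (length (nbs_below u v))))) v"
      by (rule rows_upd[where m = m]) (use inv in \<open>auto simp: list_inv_def\<close>)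
    show ?thesis
      using inv A True u le small rows' unfolding list_body_def
      by (auto simp: wp_simps list_inv_def matrix_input_def nth_append)
  next
    case False
    then show ?thesis
      using inv A u unfolding list_body_def
      by (auto simp: wp_simps list_inv_def matrix_input_def)
  qed
qed

text \<open>Each of the \<open>n\<close> columns costs 19 plus 8 for loop control. The remaining 13
  are 3 and 4 for the two assignments and 6 for entering and leaving the loop.\<close>

lemma wp_list_row:
  assumes v: "v < n" "r ''v'' = v" and inv: "list_row_inv v r m"
  shows "wp w list_row (r, m) (27 * n + 13)
    (\<lambda>(r', m') _. r' ''v'' = v \<and> list_row_inv (Suc v) (r'(''v'' := Suc v)) m')"
proof -
  have le: "v * n + n \<le> w" "v \<le> w"
    using row_le_word[OF v(1), of n] row_le_word[OF v(1), of 0] v(1) word by auto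
  let ?m = "m(''b'' := (m ''b'')(v := v * n))"
  have "rows ?m v"
    by (rule rows_upd[where m = m]) (use inv in \<open>auto simp: list_row_inv_def\<close>)
  then have init: "list_inv v 0 (r(''u'' := 0)) ?m"
    using inv v by (simp add: list_inv_def list_row_inv_def matrix_input_def)
  have "wp w (for_loop ''u'' (Reg ''n'') list_body) (r, ?m) (10 + 27 * n)
    (\<lambda>s' T'. wp w (Set ''k'' (Plus (Reg ''k'') (Reg ''n''))) s' T'
      (\<lambda>(r', m') _. r' ''v'' = v \<and> list_row_inv (Suc v) (r'(''v'' := Suc v)) m'))"
  proof (rule wp_for_loop[where N = n and I = "list_inv v" and K = 19])
    show "n \<le> w"
      using word by simp
    show "wp w list_body (r, m) 19
        (\<lambda>(r', m') _. r' ''u'' = u \<and> list_inv v (Suc u) (r'(''u'' := Suc u)) m')"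
      if "u < n" "r ''u'' = u" "list_inv v u r m" for u r m
      using wp_list_body[OF v(1) that] .
    fix r' m' T'
    assume *: "list_inv v n r' m'" "10 + 27 * n \<le> T' + (n * (19 + exp_cost (Reg ''n'') + 7) + exp_cost (Reg ''n'') + 5)"
    have "rows m' (Suc v)"
      using *(1) by (auto simp: list_inv_def rows_def less_Suc_eq nbs_def)
    then show "wp w (Set ''k'' (Plus (Reg ''k'') (Reg ''n''))) (r', m') T'
      (\<lambda>(r', m') _. r' ''v'' = v \<and> list_row_inv (Suc v) (r'(''v'' := Suc v)) m')"
      using * le by (auto simp: wp_simps list_inv_def list_row_inv_def matrix_input_def)
  qed (use init in \<open>auto simp: list_inv_def matrix_input_def\<close>)
  then show ?thesis
    using inv v le unfolding list_row_def by (simp add: wp_simps list_row_inv_def)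
qed

section \<open>Counting common neighbours and marking mandatory vertices\<close>

definition counted :: "nat \<Rightarrow> nat \<Rightarrow> nat list" where
  "counted u i = concat (map nbs (take i (nbs u)))"

text \<open>Needed to bound the entries of \<open>D\<close> by the word size.\<close>

lemma length_counted: "length (counted u i) \<le> i * n"
proof -
  have "length (concat (map nbs vs)) \<le> length vs * n" for vs
    using length_nbs(1) by (induction vs) (auto simp: add_mono)
  from this[of "take i (nbs u)"] show ?thesis
    unfolding counted_def by (rule order_trans) auto
qed

definition common_count :: "nat \<Rightarrow> nat \<Rightarrow> nat" where
  "common_count u x = count_list (counted u (length (nbs u))) x"

text \<open>If \<open>u \<sim> v\<close> and \<open>v \<sim> x\<close>, this holds iff
  \<open>x\<close> refutes \<open>mandatory_witness u v\<close>. It does not depend on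
  \<open>v\<close>, so row \<open>u\<close> of \<open>A\<close> and \<open>D\<close> suffices to
  decide it.\<close>

definition spoils :: "nat \<Rightarrow> nat \<Rightarrow> bool" where
  "spoils u x \<longleftrightarrow> common_count u x < 2 \<and> \<not> u \<sim> x \<and> x \<noteq> u"

definition marked_by :: "nat \<Rightarrow> nat \<Rightarrow> bool" where
  "marked_by u v \<longleftrightarrow> u \<sim> v \<and> (\<forall>x\<in>set (nbs v). \<not> spoils u x)"

text \<open>The lists \<open>nbs y\<close> are free of duplicates, so each neighbour
  \<open>y\<close> of \<open>u\<close> contributes one occurrence of \<open>x\<close> if
  \<open>y \<sim> x\<close> and none otherwise.\<close>

lemma common_count_eq: "common_count u x = card {y. u \<sim> y \<and> y \<sim> x}"
proof -
  have "count_list (nbs y) x = (if y \<sim> x then 1 else 0)" for y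
    using distinct_count_list[OF distinct_nbs, of y x] by (simp add: set_nbs)
  then have "count_list (concat (map nbs ys)) x = length (filter (\<lambda>y. y \<sim> x) ys)" for ys
    by (induction ys) auto
  then have "common_count u x = card (set (filter (\<lambda>y. y \<sim> x) (nbs u)))"
    using distinct_card[of "filter (\<lambda>y. y \<sim> x) (nbs u)"] distinct_nbs
    by (simp add: common_count_def counted_def del: set_filter)
  then show ?thesis
    by (simp add: set_nbs)
qed

text \<open>For an edge \<open>{v, x}\<close>, the vertex \<open>v\<close> itself is one of the common neighbours of \<open>u\<close> and \<open>x\<close>,
  which is why the counts are compared with 2.\<close>

lemma marked_by_iff: "marked_by u v \<longleftrightarrow> mandatory_witness u v"
proof -
  have "common_count u x \<ge> 2 \<longleftrightarrow> (\<exists>y. y \<noteq> v \<and> u \<sim> y \<and> y \<sim> x)" if "u \<sim> v" "v \<sim> x" for x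
  proof -
    let ?C = "{y. u \<sim> y \<and> y \<sim> x}"
    have "?C \<subseteq> {..<n}"
      using adj_in_V by auto
    then have fin: "finite ?C"
      by (rule finite_subset) simp
    have "card ?C = Suc (card (?C - {v}))"
      using that fin by (intro card.remove) auto
    then have "2 \<le> card ?C \<longleftrightarrow> ?C - {v} \<noteq> {}"
      using fin by (simp add: Suc_le_eq card_gt_0_iff)
    then show ?thesis
      unfolding common_count_eq by auto
  qed
  then show ?thesis
    unfolding marked_by_def mandatory_witness_def spoils_def set_nbs
    by (metis mem_Collect_eq not_le)
qed

text \<open>The part shared by the counting and the checking pass. The rows of \<open>D\<close>
  after row \<open>u\<close> stay zero for the vertices still to come.\<close>

definition scan_inv :: "nat \<Rightarrow> (string \<Rightarrow> nat) \<Rightarrow> (string \<Rightarrow> nat \<Rightarrow> nat) \<Rightarrow> bool" where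
  "scan_inv u r m \<longleftrightarrow> matrix_input r m \<and> rows m n \<and> r ''k'' = u * n \<and> r ''u'' = u \<and>
     (\<forall>k\<ge>Suc u * n. m ''D'' k = 0)"

definition vertex_inv :: "nat \<Rightarrow> (string \<Rightarrow> nat) \<Rightarrow> (string \<Rightarrow> nat \<Rightarrow> nat) \<Rightarrow> bool" where
  "vertex_inv u r m \<longleftrightarrow> matrix_input r m \<and> rows m n \<and> (\<forall>k\<ge>u * n. m ''D'' k = 0) \<and>
     (\<forall>v<n. m ''S'' v \<noteq> 0 \<longleftrightarrow> (\<exists>u'<u. marked_by u' v))"

text \<open>The list \<open>xs\<close> holds, with multiplicity, the last vertices of the two-edge
  walks from \<open>u\<close> traversed so far.\<close>

definition count_inv :: "nat \<Rightarrow> nat list \<Rightarrow> (string \<Rightarrow> nat) \<Rightarrow> (string \<Rightarrow> nat \<Rightarrow> nat) \<Rightarrow> bool" where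
  "count_inv u xs r m \<longleftrightarrow> scan_inv u r m \<and> (\<forall>x<n. m ''D'' (u * n + x) = count_list xs x) \<and>
     (\<forall>v<n. m ''S'' v \<noteq> 0 \<longleftrightarrow> (\<exists>u'<u. marked_by u' v))"

definition check_inv :: "nat \<Rightarrow> nat \<Rightarrow> (string \<Rightarrow> nat) \<Rightarrow> (string \<Rightarrow> nat \<Rightarrow> nat) \<Rightarrow> bool" where
  "check_inv u i r m \<longleftrightarrow> scan_inv u r m \<and> (\<forall>x<n. m ''D'' (u * n + x) = common_count u x) \<and>
     (\<forall>v<n. m ''S'' v \<noteq> 0 \<longleftrightarrow>
       (\<exists>u'<u. marked_by u' v) \<or> (v \<in> set (take i (nbs u)) \<and> marked_by u v))"

lemma rowsD:
  assumes "rows m n" "v < n"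
  shows "m ''b'' v = v * n" "m ''d'' v = length (nbs v)"
    "i < length (nbs v) \<Longrightarrow> m ''L'' (v * n + i) = nbs v ! i"
  using assms by (auto simp: rows_def)

lemma wp_count_body:
  assumes u: "u < n" and i: "i < n" and y: "y < n" "r ''y'' = y" and i': "r ''i'' = i"
    and j: "j < length (nbs y)" "r ''j'' = j"
    and inv: "count_inv u (counted u i @ take j (nbs y)) r m"
  shows "wp w count_body (r, m) 16 (\<lambda>(r', m') _. r' ''j'' = j \<and> r' ''y'' = y \<and> r' ''i'' = i \<and>
    count_inv u (counted u i @ take (Suc j) (nbs y)) (r'(''j'' := Suc j)) m')"
proof -
  define x where "x = nbs y ! j"
  have rows: "rows m n"
    using inv by (simp add: count_inv_def scan_inv_def)
  note L = rowsD(1)[OF rows y(1)] rowsD(3)[OF rows y(1) j(1), folded x_def]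
  have x: "x < n"
    unfolding x_def using j(1) by (rule nth_nbs)
  have le: "x \<le> w" "u * n + x \<le> w"
    using x word row_le_word[OF u, of x] by auto
  have D: "m ''D'' (u * n + x) = count_list (counted u i @ take j (nbs y)) x"
    using inv x by (simp add: count_inv_def)
  \<comment> \<open>A count is at most the number of walks traversed so far, hence at most
    \<open>n * n\<close>, so its successor fits into a word.\<close>
  have "count_list (counted u i @ take j (nbs y)) x \<le> length (counted u i @ take j (nbs y))"
    by (rule count_le_length)
  also have "\<dots> \<le> i * n + n"
    using length_counted[of u i] length_nbs(1)[of y] by simp
  also have "\<dots> \<le> n * n"
    using mult_le_mono1[of "Suc i" n n] i by simp
  finally have cnt: "Suc (count_list (counted u i @ take j (nbs y)) x) \<le> w"
    using word by linarith
  \<comment> \<open>The address written lies inside row \<open>u\<close>, so the later rows of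
    \<open>D\<close> remain zero.\<close>
  have "u * n + x < Suc u * n"
    using x by simp
  then show ?thesis
    using inv L le D cnt y i' j
    by (auto simp: count_body_def wp_simps count_inv_def scan_inv_def matrix_input_def rows_def
        take_Suc_conv_app_nth x_def)
qed

lemma counted_Suc: "i < length (nbs u) \<Longrightarrow> counted u (Suc i) = counted u i @ nbs (nbs u ! i)"
  by (simp add: counted_def take_Suc_conv_app_nth)

lemma wp_count_row:
  assumes u: "u < n" and i: "i < length (nbs u)" "r ''i'' = i"
    and inv: "count_inv u (counted u i) r m"
  shows "wp w count_row (r, m) (25 * \<Delta> + 12) (\<lambda>(r', m') _. r' ''i'' = i \<and>
    count_inv u (counted u (Suc i)) (r'(''i'' := Suc i)) m')"
proof -
  define y where "y = nbs u ! i"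
  have y: "y < n" "y \<le> w"
    using nth_nbs[OF i(1)] word by (auto simp: y_def)
  have i_n: "i < n"
    using i(1) length_nbs(1)[of u] by simp
  have k: "r ''k'' = u * n" and L: "m ''L'' (u * n + i) = y"
    using inv i u by (auto simp: count_inv_def scan_inv_def rows_def y_def)
  define I where "I j r m \<longleftrightarrow> r ''y'' = y \<and> r ''i'' = i \<and>
    count_inv u (counted u i @ take j (nbs y)) r m" for j r m
  have "I 0 (r(''y'' := y, ''j'' := 0)) m"
    using inv i by (simp add: I_def count_inv_def scan_inv_def matrix_input_def)
  then have "wp w (for_loop ''j'' (Arr ''d'' (Reg ''y'')) count_body) (r(''y'' := y), m) (7 + 25 * \<Delta>)
    (\<lambda>(r', m') _. r' ''i'' = i \<and> count_inv u (counted u (Suc i)) (r'(''i'' := Suc i)) m')"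
  proof (rule wp_for_loop[where N = "length (nbs y)" and K = 16 and I = I])
    fix j r m
    assume "r ''j'' = j" "I j r m"
    then show "exp_val (Arr ''d'' (Reg ''y'')) (r, m) = length (nbs y)"
      using y by (simp add: I_def count_inv_def scan_inv_def rows_def)
  next
    fix j r m
    assume "j < length (nbs y)" "r ''j'' = j" "I j r m"
    then show "wp w count_body (r, m) 16
      (\<lambda>(r', m') _. r' ''j'' = j \<and> I (Suc j) (r'(''j'' := Suc j)) m')"
      using wp_count_body[OF u i_n y(1), of r j m] by (simp add: I_def)
  next
    fix r m and T :: nat
    assume "I (length (nbs y)) r m"
    then show "(\<lambda>(r', m') _. r' ''i'' = i \<and>
      count_inv u (counted u (Suc i)) (r'(''i'' := Suc i)) m') (r, m) T"
      using i by (simp add: I_def counted_Suc y_def count_inv_def scan_inv_def matrix_input_def)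
  qed (use length_nbs[of y] y word in auto)
  then show ?thesis
    using k L i y by (simp add: count_row_def wp_simps)
qed

lemma wp_check_body:
  assumes u: "u < n" and v: "v < n" "r ''v'' = v" "r ''i'' = i"
    and j: "j < length (nbs v)" "r ''j'' = j"
    and f: "r ''f'' = (if \<exists>x\<in>set (take j (nbs v)). spoils u x then 0 else 1)"
    and inv: "check_inv u i r m"
  shows "wp w check_body (r, m) 26 (\<lambda>(r', m') _. r' ''j'' = j \<and> r' ''v'' = v \<and> r' ''i'' = i \<and>
    r' ''f'' = (if \<exists>x\<in>set (take (Suc j) (nbs v)). spoils u x then 0 else 1) \<and>
    check_inv u i (r'(''j'' := Suc j)) m')"
proof -
  define x where "x = nbs v ! j"
  have rows: "rows m n"
    using inv by (simp add: check_inv_def scan_inv_def)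
  note L = rowsD(1)[OF rows v(1)] rowsD(3)[OF rows v(1) j(1), folded x_def]
  have x: "x < n" "x \<le> w"
    using nth_nbs[OF j(1)] word by (auto simp: x_def)
  have regs: "r ''k'' = u * n" "r ''u'' = u"
    and D: "m ''D'' (u * n + x) = common_count u x"
    and A: "m ''A'' (u * n + x) = (if u \<sim> x then 1 else 0)"
    using inv x u by (simp_all add: check_inv_def scan_inv_def matrix_input_def)
  have upd: "check_inv u i (r(''x'' := c, ''j'' := c')) m"
    "check_inv u i (r(''x'' := c, ''f'' := d, ''j'' := c')) m" for c c' d
    using inv by (simp_all add: check_inv_def scan_inv_def matrix_input_def)
  have "set (take (Suc j) (nbs v)) = insert x (set (take j (nbs v)))"
    using j(1) by (simp add: take_Suc_conv_app_nth x_def)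
  then show ?thesis
    using f v j x L regs D A upd by (simp add: check_body_def wp_simps spoils_def)
qed

lemma wp_check_row:
  assumes u: "u < n" and i: "i < length (nbs u)" "r ''i'' = i" and inv: "check_inv u i r m"
  shows "wp w check_row (r, m) (35 * \<Delta> + 21) (\<lambda>(r', m') _. r' ''i'' = i \<and>
    check_inv u (Suc i) (r'(''i'' := Suc i)) m')"
proof -
  define v where "v = nbs u ! i"
  have v: "v < n" "v \<le> w" and w1: "1 \<le> w"
    using nth_nbs[OF i(1)] word by (auto simp: v_def)
  have uv: "u \<sim> v"
    using nth_mem[OF i(1)] by (simp add: v_def set_nbs)
  have k: "r ''k'' = u * n" and L: "m ''L'' (u * n + i) = v"
    using inv i u by (auto simp: check_inv_def scan_inv_def rows_def v_def)
  define I where "I j r m \<longleftrightarrow> r ''v'' = v \<and> r ''i'' = i \<and>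
    r ''f'' = (if \<exists>x\<in>set (take j (nbs v)). spoils u x then 0 else 1) \<and> check_inv u i r m" for j r m
  have "I 0 (r(''v'' := v, ''f'' := 1, ''j'' := 0)) m"
    using inv i by (simp add: I_def check_inv_def scan_inv_def matrix_input_def)
  then have "wp w (for_loop ''j'' (Arr ''d'' (Reg ''v'')) check_body)
    (r(''v'' := v, ''f'' := 1), m) (14 + 35 * \<Delta>)
    (\<lambda>s' T'. wp w (Cond (Equal (Reg ''f'') (Const 1)) (SetArr ''S'' (Reg ''v'') (Const 1)) Skip) s' T'
      (\<lambda>(r', m') _. r' ''i'' = i \<and> check_inv u (Suc i) (r'(''i'' := Suc i)) m'))"
  proof (rule wp_for_loop[where N = "length (nbs v)" and K = 26 and I = I])
    fix j r m
    assume "r ''j'' = j" "I j r m"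
    then show "exp_val (Arr ''d'' (Reg ''v'')) (r, m) = length (nbs v)"
      using v by (simp add: I_def check_inv_def scan_inv_def rows_def)
  next
    fix j r m
    assume "j < length (nbs v)" "r ''j'' = j" "I j r m"
    then show "wp w check_body (r, m) 26
      (\<lambda>(r', m') _. r' ''j'' = j \<and> I (Suc j) (r'(''j'' := Suc j)) m')"
      using wp_check_body[OF u v(1), of r i j m]
      by (simp add: I_def check_inv_def scan_inv_def matrix_input_def)
  next
    fix r' m' T'
    assume *: "I (length (nbs v)) r' m'" "14 + 35 * \<Delta> \<le> T' + (length (nbs v) *
      (26 + exp_cost (Arr ''d'' (Reg ''v'')) + 7) + exp_cost (Arr ''d'' (Reg ''v'')) + 5)"
    \<comment> \<open>Just enough for the final test and the write to \<open>S\<close>.\<close>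
    then have T': "7 \<le> T'"
      using length_nbs(2)[OF v(1)] by simp
    have regs: "r' ''v'' = v" "r' ''i'' = i"
      and f: "r' ''f'' = (if marked_by u v then 1 else 0)"
      and S: "\<forall>v<n. m' ''S'' v \<noteq> 0 \<longleftrightarrow>
        (\<exists>u'<u. marked_by u' v) \<or> (v \<in> set (take i (nbs u)) \<and> marked_by u v)"
      and frame: "scan_inv u r' m'" "\<forall>x<n. m' ''D'' (u * n + x) = common_count u x"
      using *(1) uv by (auto simp: I_def marked_by_def check_inv_def)
    have frame': "scan_inv u (r'(''i'' := c)) m'" "scan_inv u (r'(''i'' := c)) (m'(''S'' := g))"
      for c g
      using frame(1) by (simp_all add: scan_inv_def rows_def matrix_input_def)
    have take: "set (take (Suc i) (nbs u)) = insert v (set (take i (nbs u)))"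
      using i(1) by (simp add: take_Suc_conv_app_nth v_def)
    show "wp w (Cond (Equal (Reg ''f'') (Const 1)) (SetArr ''S'' (Reg ''v'') (Const 1)) Skip) (r', m') T'
      (\<lambda>(r', m') _. r' ''i'' = i \<and> check_inv u (Suc i) (r'(''i'' := Suc i)) m')"
    proof (cases "marked_by u v")
      case True
      then show ?thesis
        using T' regs f S frame(2) frame' v w1 by (simp add: wp_simps check_inv_def take)
    next
      case False
      then show ?thesis
        using T' regs f S frame(2) frame'(1) by (auto simp: wp_simps check_inv_def take)
    qed
  qed (use length_nbs[of v] v word in auto)
  then show ?thesis
    using k L i v w1 by (simp add: check_row_def wp_simps)
qed

text \<open>Both passes run over at most \<open>\<Delta>\<close> neighbours and spend linear time in
  \<open>\<Delta>\<close> on each: \<open>25 * \<Delta> + 21\<close> for counting and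
  \<open>35 * \<Delta> + 30\<close> for checking, loop control included.\<close>

lemma wp_vertex_body:
  assumes u: "u < n" "r ''u'' = u" and inv: "vertex_inv u r m"
  shows "wp w vertex_body (r, m) (60 * (\<Delta> * \<Delta>) + 51 * \<Delta> + 17) (\<lambda>(r', m') _. r' ''u'' = u \<and>
    vertex_inv (Suc u) (r'(''u'' := Suc u)) m')"
proof -
  let ?N = "length (nbs u)"
  have N: "?N \<le> \<Delta>" "?N \<le> w" and u_w: "u * n \<le> w"
    using length_nbs[of u] u word row_le_word[of u 0] by auto
  have bd: "m ''b'' u = u * n"
    using inv u by (simp add: vertex_inv_def rows_def)
  have cost: "?N * (25 * \<Delta> + 21) \<le> 25 * (\<Delta> * \<Delta>) + 21 * \<Delta>"
    "?N * (35 * \<Delta> + 30) \<le> 35 * (\<Delta> * \<Delta>) + 30 * \<Delta>"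
    using mult_le_mono1[OF N(1), of "25 * \<Delta> + 21"] mult_le_mono1[OF N(1), of "35 * \<Delta> + 30"]
    by (simp_all add: algebra_simps)
  have init: "count_inv u (counted u 0) (r(''k'' := u * n, ''i'' := 0)) m"
    using inv u by (simp add: count_inv_def scan_inv_def vertex_inv_def matrix_input_def counted_def)
  let ?Q = "\<lambda>(r', m') _. r' ''u'' = u \<and> vertex_inv (Suc u) (r'(''u'' := Suc u)) m'"
  \<comment> \<open>The checking pass comes first because it is the continuation demanded by the
    postcondition of the counting pass.\<close>
  have second: "wp w (for_loop ''i'' (Arr ''d'' (Reg ''u'')) check_row) (r', m') T' ?Q"
    if inv: "count_inv u (counted u ?N) r' m'" and T': "35 * (\<Delta> * \<Delta>) + 30 * \<Delta> + 7 \<le> T'" for r' m' T'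
  proof (rule wp_for_loop[where N = ?N and K = "35 * \<Delta> + 21" and I = "check_inv u"])
    show "check_inv u 0 (r'(''i'' := 0)) m'"
      using inv by (simp add: count_inv_def check_inv_def scan_inv_def matrix_input_def common_count_def)
    show "exp_val (Arr ''d'' (Reg ''u'')) (r, m) = ?N" if "check_inv u i r m" for i r m
      using that u by (simp add: check_inv_def scan_inv_def rows_def)
    show "wp w check_row (r, m) (35 * \<Delta> + 21)
        (\<lambda>(r', m') _. r' ''i'' = i \<and> check_inv u (Suc i) (r'(''i'' := Suc i)) m')"
      if "i < ?N" "r ''i'' = i" "check_inv u i r m" for i r m
      using wp_check_row[OF u(1) that] .
    show "?N * (35 * \<Delta> + 21 + exp_cost (Arr ''d'' (Reg ''u'')) + 7) +
        exp_cost (Arr ''d'' (Reg ''u'')) + 5 \<le> T'"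
      using cost(2) T' by (simp add: algebra_simps)
    show "?Q (r, m) T" if "check_inv u ?N r m" for r m T
      using that by (auto simp: check_inv_def scan_inv_def vertex_inv_def matrix_input_def
          less_Suc_eq marked_by_def set_nbs)
  qed (rule N)
  have "wp w (for_loop ''i'' (Arr ''d'' (Reg ''u'')) count_row) (r(''k'' := u * n), m)
    (14 + (60 * (\<Delta> * \<Delta>) + 51 * \<Delta>))
    (\<lambda>s' T'. wp w (for_loop ''i'' (Arr ''d'' (Reg ''u'')) check_row) s' T' ?Q)"
  proof (rule wp_for_loop[where N = ?N and K = "25 * \<Delta> + 12" and I = "\<lambda>i. count_inv u (counted u i)"])
    show "exp_val (Arr ''d'' (Reg ''u'')) (r, m) = ?N" if "count_inv u (counted u i) r m" for i r m
      using that u by (simp add: count_inv_def scan_inv_def rows_def)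
    show "wp w count_row (r, m) (25 * \<Delta> + 12)
        (\<lambda>(r', m') _. r' ''i'' = i \<and> count_inv u (counted u (Suc i)) (r'(''i'' := Suc i)) m')"
      if "i < ?N" "r ''i'' = i" "count_inv u (counted u i) r m" for i r m
      using wp_count_row[OF u(1) that] .
    show "?N * (25 * \<Delta> + 12 + exp_cost (Arr ''d'' (Reg ''u'')) + 7) +
        exp_cost (Arr ''d'' (Reg ''u'')) + 5 \<le> 14 + (60 * (\<Delta> * \<Delta>) + 51 * \<Delta>)"
      using cost(1) by (simp add: algebra_simps)
    show "wp w (for_loop ''i'' (Arr ''d'' (Reg ''u'')) check_row) (r', m') T' ?Q"
      if "count_inv u (counted u ?N) r' m'"
        "14 + (60 * (\<Delta> * \<Delta>) + 51 * \<Delta>) \<le> T' + (?N * (25 * \<Delta> + 12 +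
          exp_cost (Arr ''d'' (Reg ''u'')) + 7) + exp_cost (Arr ''d'' (Reg ''u'')) + 5)" for r' m' T'
      using that(2) cost(1) by (intro second that(1)) (simp add: algebra_simps)
  qed (use init N in auto)
  then show ?thesis
    using u u_w bd by (simp add: vertex_body_def wp_simps algebra_simps)
qed

text \<open>Per vertex, the bodies of the two loops take \<open>27 * n + 13\<close> and
  \<open>60 * (\<Delta> * \<Delta>) + 51 * \<Delta> + 17\<close>, and loop control takes 8 each;
  entering and leaving the loops adds 12.\<close>

lemma wp_mand_program:
  assumes "matrix_input r m" "r ''k'' = 0" "m ''d'' = (\<lambda>_. 0)" "m ''D'' = (\<lambda>_. 0)" "m ''S'' = (\<lambda>_. 0)"
  shows "wp w mand_program (r, m) (n * (27 * n + 60 * (\<Delta> * \<Delta>) + 51 * \<Delta> + 46) + 12)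
    (\<lambda>s _. \<forall>v<n. snd s ''S'' v \<noteq> 0 \<longleftrightarrow> (\<exists>u<n. marked_by u v))"
  unfolding mand_program_def wp_Seq
proof (rule wp_for_loop[where N = n and K = "27 * n + 13" and I = list_row_inv])
  let ?T = "n * (27 * n + 60 * (\<Delta> * \<Delta>) + 51 * \<Delta> + 46) + 12"
  let ?Q = "\<lambda>s _. \<forall>v<n. snd s ''S'' v \<noteq> 0 \<longleftrightarrow> (\<exists>u<n. marked_by u v)"
  show "list_row_inv 0 (r(''v'' := 0)) m"
    using assms by (simp add: list_row_inv_def matrix_input_def rows_def)
  show "wp w list_row (r, m) (27 * n + 13)
      (\<lambda>(r', m') _. r' ''v'' = v \<and> list_row_inv (Suc v) (r'(''v'' := Suc v)) m')"
    if "v < n" "r ''v'' = v" "list_row_inv v r m" for v r m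
    using wp_list_row[OF that] .
  show "wp w (for_loop ''u'' (Reg ''n'') vertex_body) (r, m) T ?Q"
    if inv: "list_row_inv n r m" and T: "?T \<le> T + (n * (27 * n + 13 + exp_cost (Reg ''n'') + 7) +
      exp_cost (Reg ''n'') + 5)" for r m T
  proof (rule wp_for_loop[where N = n and K = "60 * (\<Delta> * \<Delta>) + 51 * \<Delta> + 17" and I = vertex_inv])
    show "vertex_inv 0 (r(''u'' := 0)) m"
      using inv by (simp add: list_row_inv_def vertex_inv_def matrix_input_def)
    show "wp w vertex_body (r, m) (60 * (\<Delta> * \<Delta>) + 51 * \<Delta> + 17)
        (\<lambda>(r', m') _. r' ''u'' = u \<and> vertex_inv (Suc u) (r'(''u'' := Suc u)) m')"
      if "u < n" "r ''u'' = u" "vertex_inv u r m" for u r m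
      using wp_vertex_body[OF that] .
    show "n * (60 * (\<Delta> * \<Delta>) + 51 * \<Delta> + 17 + exp_cost (Reg ''n'') + 7) + exp_cost (Reg ''n'') + 5 \<le> T"
      using T by (simp add: algebra_simps)
  qed (use word in \<open>auto simp: vertex_inv_def matrix_input_def\<close>)
qed (use word in \<open>auto simp: list_row_inv_def matrix_input_def algebra_simps\<close>)

end

section \<open>From the input matrix to the asymptotic bound\<close>

lemma matrix_entry:
  fixes v u n :: nat
  assumes "v < n" "u < n"
  shows "(v * n + u) div n = v" "(v * n + u) mod n = u" "v * n + u < n * n"
proof -
  show "(v * n + u) div n = v" "(v * n + u) mod n = u"
    using assms by auto
  have "Suc v * n \<le> n * n"
    using assms by (intro mult_le_mono1) simp
  then show "v * n + u < n * n"
    using assms by simp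
qed

lemma mand_program_correct:
  assumes G: "simple_graph {..<n} E"
  shows "\<exists>t s. exec (4 * n ^ 4) mand_program (input n E) t s \<and>
    t \<le> 200 * (card {..<n} * (card {..<n} + (max_degree {..<n} E)\<^sup>2)) \<and>
    output_set n s = Mand {..<n} E"
proof -
  interpret sgraph "{..<n}" E
    using G by unfold_locales
  let ?\<Delta> = "max_degree {..<n} E"
  have n: "1 \<le> n"
    using G by (cases n) (auto simp: simple_graph_def)
  interpret mand_run n E "4 * n ^ 4" ?\<Delta>
  proof
    \<comment> \<open>The required word size is a sum of four terms, each at most
      \<open>n ^ 4\<close>; thus 4 can serve both as factor and as exponent in
      \<open>k * n ^ k\<close>.\<close>
    have "n\<^sup>2 \<le> n ^ 4" "n \<le> n ^ 4" "1 \<le> n ^ 4"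
      using n by (auto intro: power_increasing self_le_power)
    then show "n * n + n + 2 \<le> 4 * n ^ 4"
      by (simp add: power2_eq_square)
    fix v
    assume "v < n"
    have "length (filter (\<lambda>u. v \<sim> u) [0..<n]) = card (set (filter (\<lambda>u. v \<sim> u) [0..<n]))"
      by (simp only: distinct_card distinct_filter distinct_upt)
    also have "set (filter (\<lambda>u. v \<sim> u) [0..<n]) = {u \<in> {..<n}. u \<sim> v}"
      by (auto simp: insert_commute)
    also have "card \<dots> \<le> ?\<Delta>"
      using \<open>v < n\<close> unfolding max_degree_def degree_def[symmetric] by (intro Max_ge) auto
    finally show "length (filter (\<lambda>u. v \<sim> u) [0..<n]) \<le> ?\<Delta>" .
  qed
  obtain r m where rm: "input n E = (r, m)"
    by (cases "input n E")
  have "wp (4 * n ^ 4) mand_program (r, m)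
    (n * (27 * n + 60 * (?\<Delta> * ?\<Delta>) + 51 * ?\<Delta> + 46) + 12)
    (\<lambda>s _. \<forall>v<n. snd s ''S'' v \<noteq> 0 \<longleftrightarrow> (\<exists>u<n. marked_by u v))"
    using rm by (intro wp_mand_program) (auto simp: input_def matrix_input_def matrix_entry)
  then obtain t s where t: "exec (4 * n ^ 4) mand_program (input n E) t s"
    "t \<le> n * (27 * n + 60 * (?\<Delta> * ?\<Delta>) + 51 * ?\<Delta> + 46) + 12"
    and S: "\<forall>v<n. snd s ''S'' v \<noteq> 0 \<longleftrightarrow> (\<exists>u<n. marked_by u v)"
    unfolding wp_def rm by blast
  \<comment> \<open>Here \<open>d\<close> and \<open>q\<close> stand for \<open>\<Delta>\<close> and
    its square. As \<open>1 \<le> n\<close>, the left side is at most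
    \<open>85 * n + 111 * q\<close>, so 200 is a generous factor.\<close>
  have "27 * n + 60 * q + 51 * d + 46 + 12 \<le> 200 * (n + q)" if "d \<le> q" for d q :: nat
    using that n unfolding distrib_left by linarith
  from this[of ?\<Delta> "?\<Delta> * ?\<Delta>"] have "27 * n + 60 * (?\<Delta> * ?\<Delta>) + 51 * ?\<Delta> + 46 + 12 \<le> 200 * (n + ?\<Delta> * ?\<Delta>)"
    by (cases ?\<Delta>) auto
  then have "n * (27 * n + 60 * (?\<Delta> * ?\<Delta>) + 51 * ?\<Delta> + 46 + 12) \<le> n * (200 * (n + ?\<Delta> * ?\<Delta>))"
    by (rule mult_le_mono2)
  then have "n * (27 * n + 60 * (?\<Delta> * ?\<Delta>) + 51 * ?\<Delta> + 46) + n * 12 \<le> 200 * (n * (n + ?\<Delta> * ?\<Delta>))"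
    by (simp only: distrib_left mult.left_commute)
  with t(2) n have "t \<le> 200 * (card {..<n} * (card {..<n} + ?\<Delta>\<^sup>2))"
    by (simp add: power2_eq_square)
  moreover have "output_set n s = Mand {..<n} E"
  proof (rule set_eqI)
    fix v
    \<comment> \<open>Every witness is a vertex and is therefore tried by the program.\<close>
    have "u < n" if "mandatory_witness u v" for u
      using that adj_in_V(1)[of u v] by (simp add: mandatory_witness_def)
    then show "v \<in> output_set n s \<longleftrightarrow> v \<in> Mand {..<n} E"
      using S unfolding output_set_def Mand_iff marked_by_iff by auto
  qed
  ultimately show ?thesis
    using t(1) by blast
qed

theorem theorem3:
  shows "(\<exists>P. computes_in_time P (\<lambda>V E. True) (\<lambda>V E S. S = Mand V E)
            (\<lambda>V E. card V * (card V + (max_degree V E)\<^sup>2))) \<and>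
         (\<exists>P. computes_in_time P chordal minimum_meg_set
            (\<lambda>V E. card V * (card V + (max_degree V E)\<^sup>2)))"
proof (intro conjI exI[of _ mand_program])
  show "computes_in_time mand_program (\<lambda>V E. True) (\<lambda>V E S. S = Mand V E)
    (\<lambda>V E. card V * (card V + (max_degree V E)\<^sup>2))"
    unfolding computes_in_time_def using mand_program_correct by blast
  \<comment> \<open>On chordal graphs the set computed for the first claim already solves the
    second, so one program serves both.\<close>
  have "minimum_meg_set {..<n} E (Mand {..<n} E)"
    if "simple_graph {..<n} E" "chordal {..<n} E" for n :: nat and E
    using that by (intro sgraph.chordal_minimum_meg_set) (simp_all add: sgraph_def)
  then show "computes_in_time mand_program chordal minimum_meg_set
    (\<lambda>V E. card V * (card V + (max_degree V E)\<^sup>2))"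
    unfolding computes_in_time_def using mand_program_correct by metis
qed

end
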